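(* For $1\le n\le 20$, the set of positive integers $\ell$ with $\Delta_\ell(n)<0$ is exactly: $n=1$: $\ell\ge 2$; $n=2$: empty; $n=3$: $2\le\ell\le 13$; $n=4$: $\ell\ge 16$; $n=5$: $2\le \ell\le 19$; $n=6$: empty; $n=7$: $\ell\ge 2$; $n=8$: $15\le\ell\le 26$; $n=9$: $2\le\ell\le 12$; $n=10$: $\ell\ge 22$; $n=11$: $2\le\ell\le 35$; $n=12$: empty; $n=13$: $2\le\ell\le 9$ or $\ell\ge 26$; $n=14$: $20\le\ell\le 44$; $n=15$: $2\le\ell\le 8$; $n=16$: $\ell\ge 29$; $n=17$: $2\le\ell\le 6$ or $24\le\ell\le 54$; $n=18$: empty; $n=19$: $2\le\ell\le 4$ or $\ell\ge 32$; $n=20$: $\ell\ge 27$.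
   Context: For integers $n\geq 0$ let $S_n$ be the symmetric group on $n$ elements ($S_0$ trivial). For an integer $\ell\geq 1$ let $C_{\ell,n}=\{(\pi_1,\dots,\pi_\ell)\in S_n^\ell : \pi_j\pi_k=\pi_k\pi_j \text{ for all } 1\le j,k\le \ell\}$ and $N_\ell(n)=|C_{\ell,n}|/|S_n|$ (so $N_\ell(0)=1$). Define $\Delta_\ell(n)=N_\ell(n)^2-N_\ell(n-1)N_\ell(n+1)$ for $n\geq 1$; a pair $(n,\ell)$ with $\Delta_\ell(n)<0$ is called an exception. *)

theory Defs
  imports "HOL-Combinatorics.Permutations" Complex_Main
begin

definition sym_grp :: "nat \<Rightarrow> (nat \<Rightarrow> nat) set" where
  "sym_grp n = {p. p permutes {..<n}}"

definition comm_tuples :: "nat \<Rightarrow> nat \<Rightarrow> (nat \<Rightarrow> nat) list set" where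
  "comm_tuples l n = {ps. length ps = l \<and> (\<forall>p\<in>set ps. p \<in> sym_grp n) \<and>
      (\<forall>j<l. \<forall>k<l. ps ! j \<circ> ps ! k = ps ! k \<circ> ps ! j)}"

definition N :: "nat \<Rightarrow> nat \<Rightarrow> rat" where
  "N l n = of_nat (card (comm_tuples l n)) / of_nat (card (sym_grp n))"

text \<open>Delta_l(n) = N_l(n)^2 - N_l(n-1) N_l(n+1), used for n \<ge> 1.\<close>
definition Delta :: "nat \<Rightarrow> nat \<Rightarrow> rat" where
  "Delta l n = N l n ^ 2 - N l (n - 1) * N l (n + 1)"

definition exc_set :: "nat \<Rightarrow> nat set" where
  "exc_set n = (
     if n = 1 then {2..} else
     if n = 2 then {} else
     if n = 3 then {2..13} else
     if n = 4 then {16..} else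
     if n = 5 then {2..19} else
     if n = 6 then {} else
     if n = 7 then {2..} else
     if n = 8 then {15..26} else
     if n = 9 then {2..12} else
     if n = 10 then {22..} else
     if n = 11 then {2..35} else
     if n = 12 then {} else
     if n = 13 then {2..9} \<union> {26..} else
     if n = 14 then {20..44} else
     if n = 15 then {2..8} else
     if n = 16 then {29..} else
     if n = 17 then {2..6} \<union> {24..54} else
     if n = 18 then {} else
     if n = 19 then {2..4} \<union> {32..} else
     if n = 20 then {27..} else {})"

end

theory Submission
  imports Defs "HOL-Combinatorics.Cycles"
begin

text \<open>
  Let \<open>J\<^sub>l(k)\<close> be the number of subgroups of index \<open>k\<close> in \<open>\<int>\<^sup>l\<close>. Splitting off the orbit of one point
  from a commuting tuple gives \<open>n N\<^sub>l(n) = \<Sum>\<^sub>k J\<^sub>l(k) N\<^sub>l(n - k)\<close>, because there are \<open>(k - 1)! J\<^sub>l(k)\<close>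
  transitive commuting \<open>l\<close>-tuples on \<open>k\<close> points. In a transitive tuple the last \<open>l\<close> of \<open>l + 1\<close>
  permutations have orbits of a common size \<open>d\<close> which the remaining one permutes cyclically, whence
  \<open>J\<^sub>l\<^sub>+\<^sub>1(k) = \<Sum>\<^sub>d\<^sub>|\<^sub>k d J\<^sub>l(d)\<close>.

  For \<open>l < 80\<close> the signs follow by running this recurrence in interval arithmetic. For \<open>l \<ge> 80\<close>, \<open>N\<^sub>l(n)\<close>
  is dominated by \<open>m\<^sup>l\<close> where \<open>m\<close> is the largest product of the parts of a partition of \<open>n\<close>, namely
  \<open>3\<^sup>q\<close>, \<open>4 * 3\<^sup>q\<^sup>-\<^sup>1\<close> or \<open>2 * 3\<^sup>q\<close>. So the sign is decided by the bases if \<open>n \<equiv> 0, 1 (mod 3)\<close>, and by the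
  coefficients if \<open>n \<equiv> 2\<close>; for \<open>n = 20\<close> these coincide, and the next term, of relative size \<open>(8/9)\<^sup>l\<close>,
  decides.
\<close>

section \<open>Commuting tuples of permutations\<close>

text \<open>The factor \<open>d\<close> in the recurrence for \<open>J\<close> comes from
  regularity: the group generated by a transitive commuting tuple is its own centralizer and acts
  simply transitively. Once the blocks are arranged in a cycle, the element closing the cycle is
  therefore determined by the image of one point, which can be any of \<open>d\<close> points.

  For large \<open>l\<close> a part \<open>k\<close> contributes \<open>J_l(k)/k\<close>, which is
  about \<open>2^l/2\<close>, \<open>3^l/6\<close>, \<open>4^l/6\<close> for
  \<open>k = 2, 3, 4\<close>. So the coefficient of the main term of \<open>N_l(n)\<close> is
  \<open>1/(6^q q!)\<close> for \<open>n = 3q\<close>, half of that for \<open>n = 3q + 2\<close>,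
  and \<open>(7/24)/(6^(q-1) (q-1)!)\<close> for \<open>n = 3q + 1\<close> with
  \<open>q \<ge> 1\<close>, where \<open>7/24 = 1/6 + 1/8\<close> collects the parts 4 and 2+2. For
  \<open>n = 3q + 2\<close> the leading terms of \<open>N_l(n-1) N_l(n+1)\<close> and
  \<open>N_l(n)^2\<close> are then in the ratio \<open>7q : 6(q+1)\<close>. This is below 1 for
  \<open>q < 6\<close> and equal to 1 at \<open>q = 6\<close>, which is the coincidence at
  \<open>n = 20\<close>.

  The threshold 80 lies well beyond the last change of sign, between 54 and 55 for
  \<open>n = 17\<close>, so powers such as \<open>(8/9)^80\<close> are small enough for crude
  constants.\<close>

inductive_set tuple_orbit :: "('a \<Rightarrow> 'a) list \<Rightarrow> 'a \<Rightarrow> 'a set"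
  for ps :: "('a \<Rightarrow> 'a) list" and x :: 'a where
  base: "x \<in> tuple_orbit ps x"
| step: "y \<in> tuple_orbit ps x \<Longrightarrow> p \<in> set ps \<Longrightarrow> p y \<in> tuple_orbit ps x"

text \<open>The carrier and its type are arbitrary because tuples get restricted to orbits and
  rebuilt on products \<open>{..<m} \<times> Y\<close>.\<close>

definition commuting_perms :: "nat \<Rightarrow> 'a set \<Rightarrow> ('a \<Rightarrow> 'a) list set" where
  "commuting_perms l X = {ps. length ps = l \<and> (\<forall>p\<in>set ps. p permutes X) \<and>
      (\<forall>p\<in>set ps. \<forall>q\<in>set ps. p \<circ> q = q \<circ> p)}"

definition transitive_perms :: "nat \<Rightarrow> 'a set \<Rightarrow> 'a \<Rightarrow> ('a \<Rightarrow> 'a) list set" where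
  "transitive_perms l X x = {ps \<in> commuting_perms l X. tuple_orbit ps x = X}"

lemma commuting_permsD:
  assumes "ps \<in> commuting_perms l X"
  shows "length ps = l" "p \<in> set ps \<Longrightarrow> p permutes X"
    "p \<in> set ps \<Longrightarrow> q \<in> set ps \<Longrightarrow> p (q y) = q (p y)"
  using assms by (auto simp: commuting_perms_def fun_eq_iff)

lemma transitive_permsD:
  assumes "ps \<in> transitive_perms l X x"
  shows "ps \<in> commuting_perms l X" "tuple_orbit ps x = X"
  using assms by (auto simp: transitive_perms_def)

lemma comm_tuples_eq: "comm_tuples l n = commuting_perms l {..<n}"
  unfolding comm_tuples_def commuting_perms_def sym_grp_def
  by (auto simp: all_set_conv_all_nth)

lemma finite_commuting_perms:
  assumes "finite X"
  shows "finite (commuting_perms l X)"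
proof (rule finite_subset)
  show "commuting_perms l X \<subseteq> {ps. set ps \<subseteq> {p. p permutes X} \<and> length ps = l}"
    by (auto simp: commuting_perms_def)
  show "finite {ps. set ps \<subseteq> {p. p permutes X} \<and> length ps = l}"
    using assms by (intro finite_lists_length_eq finite_permutations)
qed

lemma finite_transitive_perms: "finite X \<Longrightarrow> finite (transitive_perms l X x)"
  by (simp add: transitive_perms_def finite_commuting_perms)

section \<open>Orbits of a commuting tuple\<close>

lemma tuple_orbit_subset:
  assumes "\<And>p y. p \<in> set ps \<Longrightarrow> y \<in> X \<Longrightarrow> p y \<in> X" and "x \<in> X"
  shows "tuple_orbit ps x \<subseteq> X"
proof
  fix y assume "y \<in> tuple_orbit ps x"
  then show "y \<in> X"
  proof induction
    case (step y p)
    then show ?case using assms(1) by blast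
  qed (rule assms(2))
qed

lemma tuple_orbit_mono: "tuple_orbit ps x \<subseteq> tuple_orbit qs x" if "set ps \<subseteq> set qs"
proof (rule tuple_orbit_subset)
  fix p y assume "p \<in> set ps" "y \<in> tuple_orbit qs x"
  with that show "p y \<in> tuple_orbit qs x" using tuple_orbit.step[of y qs x p] by blast
qed (rule tuple_orbit.base)

lemma tuple_orbit_subset_perms:
  assumes "ps \<in> commuting_perms l X" "x \<in> X"
  shows "tuple_orbit ps x \<subseteq> X"
proof (rule tuple_orbit_subset)
  fix p y assume "p \<in> set ps" "y \<in> X"
  then show "p y \<in> X" using commuting_permsD(2)[OF assms(1)] permutes_in_image by metis
qed (rule assms(2))

lemma tuple_orbit_map_cong:
  assumes "\<And>p y. p \<in> set ps \<Longrightarrow> y \<in> tuple_orbit ps x \<Longrightarrow> f p y = p y"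
  shows "tuple_orbit (map f ps) x = tuple_orbit ps x"
proof
  show "tuple_orbit (map f ps) x \<subseteq> tuple_orbit ps x"
  proof (rule tuple_orbit_subset)
    fix q y assume "q \<in> set (map f ps)" and y: "y \<in> tuple_orbit ps x"
    then obtain p where p: "p \<in> set ps" "q = f p" by auto
    then show "q y \<in> tuple_orbit ps x" using assms[OF p(1) y] tuple_orbit.step[OF y p(1)] by simp
  qed (rule tuple_orbit.base)
  show "tuple_orbit ps x \<subseteq> tuple_orbit (map f ps) x"
  proof
    fix y assume "y \<in> tuple_orbit ps x"
    then show "y \<in> tuple_orbit (map f ps) x"
    proof induction
      case (step y p)
      then have "f p y \<in> tuple_orbit (map f ps) x" using tuple_orbit.step[OF step(3), of "f p"] by simp
      with step assms show ?case by simp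
    qed (rule tuple_orbit.base)
  qed
qed

text \<open>Agreement is required only on the orbit of the modified tuple. This serves when that
  orbit is the known one, as for a tuple glued from two pieces and restricted to \<open>Y\<close>
  again.\<close>

lemma tuple_orbit_map_cong':
  assumes "\<And>p y. p \<in> set ps \<Longrightarrow> y \<in> tuple_orbit (map f ps) x \<Longrightarrow> f p y = p y"
  shows "tuple_orbit (map f ps) x = tuple_orbit ps x"
proof
  show "tuple_orbit ps x \<subseteq> tuple_orbit (map f ps) x"
  proof (rule tuple_orbit_subset)
    fix p y assume p: "p \<in> set ps" and y: "y \<in> tuple_orbit (map f ps) x"
    then have "f p y \<in> tuple_orbit (map f ps) x" using tuple_orbit.step[OF y, of "f p"] by simp
    then show "p y \<in> tuple_orbit (map f ps) x" using assms[OF p y] by simp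
  qed (rule tuple_orbit.base)
  show "tuple_orbit (map f ps) x \<subseteq> tuple_orbit ps x"
  proof
    fix y assume "y \<in> tuple_orbit (map f ps) x"
    then show "y \<in> tuple_orbit ps x"
    proof induction
      case (step y q)
      then obtain p where p: "p \<in> set ps" "q = f p" by auto
      then show ?case using assms[OF p(1) step(1)] tuple_orbit.step[OF step(3) p(1)] by simp
    qed (rule tuple_orbit.base)
  qed
qed

lemma bij_betw_tuple_orbit:
  assumes "ps \<in> commuting_perms l X" "finite X" "x \<in> X" "p \<in> set ps"
  shows "bij_betw p (tuple_orbit ps x) (tuple_orbit ps x)"
proof -
  have "finite (tuple_orbit ps x)"
    using tuple_orbit_subset_perms[OF assms(1,3)] assms(2) finite_subset by blast
  moreover have "inj_on p (tuple_orbit ps x)"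
    using commuting_permsD(2)[OF assms(1,4)] permutes_inj_on by blast
  moreover have "p ` tuple_orbit ps x \<subseteq> tuple_orbit ps x"
    using tuple_orbit.step[OF _ assms(4)] by (rule image_subsetI)
  ultimately show ?thesis by (simp add: bij_betw_def endo_inj_surj)
qed

text \<open>The witness \<open>g\<close> is a word in the entries of \<open>ps\<close> leading from
  \<open>x\<close> to \<open>y\<close>; whatever commutes with the entries commutes with the word.
  The quantifier over \<open>h\<close> allows maps outside \<open>ps\<close>, in particular powers
  of a further permutation \<open>q\<close>.\<close>

lemma tuple_orbit_centralizer:
  assumes "ps \<in> commuting_perms l X" "finite X" "x \<in> X" "y \<in> tuple_orbit ps x"
  shows "\<exists>g. g x = y \<and> g permutes X \<and> bij_betw g (tuple_orbit ps x) (tuple_orbit ps x) \<and>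
    (\<forall>h. (\<forall>p\<in>set ps. h \<circ> p = p \<circ> h) \<longrightarrow> h \<circ> g = g \<circ> h)"
  using assms(4)
proof induction
  case base
  show ?case by (rule exI[of _ id]) (auto simp: bij_betw_def simp del: id_apply, auto)
next
  case (step y p)
  then obtain g where g: "g x = y" "g permutes X"
    "bij_betw g (tuple_orbit ps x) (tuple_orbit ps x)"
    "\<And>h. (\<forall>p\<in>set ps. h \<circ> p = p \<circ> h) \<Longrightarrow> h \<circ> g = g \<circ> h" by blast
  show ?case
  proof (intro exI[of _ "p \<circ> g"] conjI allI impI)
    show "p \<circ> g permutes X"
      using g(2) commuting_permsD(2)[OF assms(1) step(2)] by (rule permutes_compose)
    show "bij_betw (p \<circ> g) (tuple_orbit ps x) (tuple_orbit ps x)"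
      using g(3) bij_betw_tuple_orbit[OF assms(1-3) step(2)] by (rule bij_betw_trans)
    fix h assume "\<forall>p\<in>set ps. h \<circ> p = p \<circ> h"
    then show "h \<circ> (p \<circ> g) = (p \<circ> g) \<circ> h"
      using g(4)[of h] step(2) by (metis comp_assoc)
  qed (use g in auto)
qed

text \<open>Rigidity of equivariant maps: following a word from \<open>x\<close> to \<open>y\<close>
  forces the value at \<open>y\<close> from the value at \<open>x\<close>.\<close>

lemma tuple_orbit_eqI:
  assumes "y \<in> tuple_orbit ps x" "h x = h' x"
    and "\<And>p y. p \<in> set ps \<Longrightarrow> y \<in> tuple_orbit ps x \<Longrightarrow> h (p y) = f p (h y)"
    and "\<And>p y. p \<in> set ps \<Longrightarrow> y \<in> tuple_orbit ps x \<Longrightarrow> h' (p y) = f p (h' y)"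
  shows "h y = h' y"
  using assms(1)
proof induction
  case (step y p)
  then show ?case using assms(3)[OF step(2,1)] assms(4)[OF step(2,1)] by metis
qed (rule assms(2))

section \<open>Transport of tuples along bijections\<close>

lemma map_permutation_commuting_perms:
  assumes "bij_betw f A B" "ps \<in> commuting_perms l A"
  shows "map (map_permutation A f) ps \<in> commuting_perms l B"
proof -
  have inj: "inj_on f A" using assms(1) by (simp add: bij_betw_def)
  have *: "map_permutation A f p \<circ> map_permutation A f q = map_permutation A f (p \<circ> q)"
    if "p \<in> set ps" "q \<in> set ps" for p q
    using map_permutation_compose'[OF inj, of q p] commuting_permsD(2)[OF assms(2)] that by simp
  show ?thesis
    using assms(2) map_permutation_permutes[OF assms(1)]
    unfolding commuting_perms_def by (auto simp: *)
qed

lemma tuple_orbit_map_permutation: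
  assumes "bij_betw f A B" "ps \<in> commuting_perms l A" "x \<in> A"
  shows "tuple_orbit (map (map_permutation A f) ps) (f x) = f ` tuple_orbit ps x"
proof -
  have inj: "inj_on f A" using assms(1) by (simp add: bij_betw_def)
  note sub = tuple_orbit_subset_perms[OF assms(2,3)]
  have app: "map_permutation A f p (f y) = f (p y)" if "y \<in> tuple_orbit ps x" for p y
    using map_permutation_apply[OF inj] sub that by blast
  show ?thesis
  proof
    show "tuple_orbit (map (map_permutation A f) ps) (f x) \<subseteq> f ` tuple_orbit ps x"
    proof (rule tuple_orbit_subset)
      fix q z assume "q \<in> set (map (map_permutation A f) ps)" "z \<in> f ` tuple_orbit ps x"
      then obtain p y where p: "p \<in> set ps" "q = map_permutation A f p" "y \<in> tuple_orbit ps x" "z = f y"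
        by auto
      then show "q z \<in> f ` tuple_orbit ps x" using app[OF p(3)] tuple_orbit.step[OF p(3,1)] by simp
    qed (simp add: tuple_orbit.base)
    have "f y \<in> tuple_orbit (map (map_permutation A f) ps) (f x)" if "y \<in> tuple_orbit ps x" for y
      using that
    proof induction
      case (step y p)
      then have "map_permutation A f p (f y) \<in> tuple_orbit (map (map_permutation A f) ps) (f x)"
        using tuple_orbit.step[OF step(3), of "map_permutation A f p"] by simp
      then show ?case using step app by simp
    qed (rule tuple_orbit.base)
    then show "f ` tuple_orbit ps x \<subseteq> tuple_orbit (map (map_permutation A f) ps) (f x)" by blast
  qed
qed

lemma map_permutation_transitive_perms:
  assumes "bij_betw f A B" "ps \<in> transitive_perms l A x" "x \<in> A"
  shows "map (map_permutation A f) ps \<in> transitive_perms l B (f x)"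
  using assms map_permutation_commuting_perms[OF assms(1)]
    tuple_orbit_map_permutation[OF assms(1) _ assms(3)]
  by (auto simp: transitive_perms_def bij_betw_def)

lemma inj_on_map_permutation:
  assumes "bij_betw f A B"
  shows "inj_on (map (map_permutation A f)) (commuting_perms l A)"
proof (rule inj_on_inverseI[where g = "map (map_permutation B (inv_into A f))"])
  fix ps assume ps: "ps \<in> commuting_perms l A"
  have "map_permutation B (inv_into A f) (map_permutation A f p) = p" if "p \<in> set ps" for p
    using assms commuting_permsD(2)[OF ps that]
    by (rule map_permutation_compose_inv) (use assms in \<open>simp add: bij_betw_def\<close>)
  then show "map (map_permutation B (inv_into A f)) (map (map_permutation A f) ps) = ps"
    by (simp add: map_idI)
qed

lemma card_commuting_perms_cong:
  assumes "finite A" "finite B" "card A = card B"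
  shows "card (commuting_perms l A) = card (commuting_perms l B)"
proof -
  \<comment> \<open>The type variables are fresh, so the inequality can be used in both directions
    although the two carriers may have different types.\<close>
  have le: "card (commuting_perms l A) \<le> card (commuting_perms l B)"
    if AB: "finite A" "finite B" "card A = card B" for A :: "'c set" and B :: "'d set"
  proof -
    obtain f where f: "bij_betw f A B" using finite_same_card_bij[OF AB] by blast
    have "map (map_permutation A f) ` commuting_perms l A \<subseteq> commuting_perms l B"
      using map_permutation_commuting_perms[OF f] by blast
    then show ?thesis
      using inj_on_map_permutation[OF f] finite_commuting_perms[OF AB(2)] by (intro card_inj_on_le)
  qed
  show ?thesis using le[of A B] le[of B A] assms by simp
qed

lemma ex_bij_betw_pointed:
  assumes "finite A" "finite B" "card A = card B" "x \<in> A" "y \<in> B"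
  shows "\<exists>f. bij_betw f A B \<and> f x = y"
proof -
  have "card (A - {x}) = card (B - {y})" using assms by simp
  then obtain f where f: "bij_betw f (A - {x}) (B - {y})"
    using finite_same_card_bij assms by (metis finite_Diff)
  have "bij_betw (f(x := y)) (insert x (A - {x})) (insert y (B - {y}))"
  proof -
    have "bij_betw (f(x := y)) (A - {x}) (B - {y})"
      using f by (rule bij_betw_cong[THEN iffD1, rotated]) auto
    then show ?thesis using notIn_Un_bij_betw[of x "A - {x}" "f(x := y)" "B - {y}"] by simp
  qed
  then show ?thesis using assms by (intro exI[of _ "f(x := y)"]) (simp add: insert_absorb)
qed

lemma card_transitive_perms_cong:
  assumes "finite A" "finite B" "card A = card B" "x \<in> A" "y \<in> B"
  shows "card (transitive_perms l A x) = card (transitive_perms l B y)"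
proof -
  have le: "card (transitive_perms l A x) \<le> card (transitive_perms l B y)"
    if AB: "finite A" "finite B" "card A = card B" "x \<in> A" "y \<in> B"
    for A :: "'c set" and B :: "'d set" and x y
  proof -
    obtain f where f: "bij_betw f A B" "f x = y" using ex_bij_betw_pointed[OF AB] by blast
    have "map (map_permutation A f) ` transitive_perms l A x \<subseteq> transitive_perms l B y"
      using map_permutation_transitive_perms[OF f(1) _ AB(4)] f(2) by (auto intro!: image_subsetI)
    moreover have "inj_on (map (map_permutation A f)) (transitive_perms l A x)"
      using inj_on_map_permutation[OF f(1)] by (rule inj_on_subset) (auto simp: transitive_perms_def)
    ultimately show ?thesis
      using finite_transitive_perms[OF AB(2)] by (intro card_inj_on_le)
  qed
  show ?thesis using le[of A B x y] le[of B A y x] assms by simp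
qed

section \<open>Splitting a tuple along the orbit of one point\<close>

lemma restrict_id_commuting_perms:
  assumes "ps \<in> commuting_perms l X" "\<And>p. p \<in> set ps \<Longrightarrow> bij_betw p Y Y"
  shows "map (\<lambda>p. restrict_id p Y) ps \<in> commuting_perms l Y"
proof -
  have mem: "p y \<in> Y" if "p \<in> set ps" "y \<in> Y" for p y
    using assms(2)[OF that(1)] that(2) by (auto simp: bij_betw_def)
  show ?thesis
    using commuting_permsD(1,3)[OF assms(1)] permutes_restrict_id[OF assms(2)]
    by (auto simp: commuting_perms_def restrict_id_def fun_eq_iff mem)
qed

text \<open>Each entry permutes \<open>X\<close> and maps \<open>Y\<close> onto itself, hence also
  preserves \<open>X - Y\<close>, and so is the product of its two restrictions. Conversely,
  permutations supported on \<open>Y\<close> and on \<open>X - Y\<close> do not interfere, so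
  composing entry by entry is the inverse map.\<close>

lemma bij_betw_split_tuple:
  assumes "finite X" "x \<in> Y" "Y \<subseteq> X"
  shows "bij_betw (\<lambda>ps. (map (\<lambda>p. restrict_id p Y) ps, map (\<lambda>p. restrict_id p (X - Y)) ps))
    {ps \<in> commuting_perms l X. tuple_orbit ps x = Y}
    (transitive_perms l Y x \<times> commuting_perms l (X - Y))"
proof (rule bij_betw_byWitness[where f' = "\<lambda>(as, bs). map2 (\<circ>) as bs"])
  let ?S = "{ps \<in> commuting_perms l X. tuple_orbit ps x = Y}"
  let ?r = "\<lambda>ps. (map (\<lambda>p. restrict_id p Y) ps, map (\<lambda>p. restrict_id p (X - Y)) ps)"
  have bij: "bij_betw p Y Y" "bij_betw p (X - Y) (X - Y)" if "ps \<in> ?S" "p \<in> set ps" for ps p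
  proof -
    show Y: "bij_betw p Y Y" using bij_betw_tuple_orbit[of ps l X x p] that assms by auto
    have "bij_betw p X X"
      using commuting_permsD(2)[of ps l X p] that permutes_imp_bij by blast
    then show "bij_betw p (X - Y) (X - Y)"
      using Y assms(3) by (simp add: bij_betw_DiffI)
  qed
  show "?r ` ?S \<subseteq> transitive_perms l Y x \<times> commuting_perms l (X - Y)"
  proof -
    have "map (\<lambda>p. restrict_id p Y) ps \<in> transitive_perms l Y x \<and>
        map (\<lambda>p. restrict_id p (X - Y)) ps \<in> commuting_perms l (X - Y)" if ps: "ps \<in> ?S" for ps
    proof -
      have "tuple_orbit (map (\<lambda>p. restrict_id p Y) ps) x = tuple_orbit ps x"
        by (rule tuple_orbit_map_cong) (use ps in auto)
      then show ?thesis
        using ps restrict_id_commuting_perms[of ps l X] bij[OF ps] by (auto simp: transitive_perms_def)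
    qed
    then show ?thesis by blast
  qed
  show "\<forall>ps\<in>?S. (case ?r ps of (as, bs) \<Rightarrow> map2 (\<circ>) as bs) = ps"
  proof
    fix ps assume ps: "ps \<in> ?S"
    have "restrict_id p Y \<circ> restrict_id p (X - Y) = p" if "p \<in> set ps" for p
    proof
      fix y
      have "p permutes X" using ps that by (auto simp: commuting_permsD)
      moreover have "y \<in> X - Y \<Longrightarrow> p y \<in> X - Y" using bij(2)[OF ps that] by (auto simp: bij_betw_def)
      ultimately show "(restrict_id p Y \<circ> restrict_id p (X - Y)) y = p y"
        using assms(3) by (cases "y \<in> X"; cases "y \<in> Y") (auto simp: permutes_not_in restrict_id_def)
    qed
    then show "(case ?r ps of (as, bs) \<Rightarrow> map2 (\<circ>) as bs) = ps"
      by (simp add: zip_map_map map_idI zip_same_conv_map)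
  qed
  have main: "?r (map2 (\<circ>) as bs) = (as, bs) \<and> map2 (\<circ>) as bs \<in> ?S"
    if as: "as \<in> transitive_perms l Y x" and bs: "bs \<in> commuting_perms l (X - Y)" for as bs
  proof -
    note ac = transitive_permsD[OF as]
    note len = commuting_permsD(1)[OF ac(1)] commuting_permsD(1)[OF bs]
    have pa: "a permutes Y" if "a \<in> set as" for a using ac(1) that by (auto simp: commuting_permsD)
    have pb: "b permutes (X - Y)" if "b \<in> set bs" for b using bs that by (auto simp: commuting_permsD)
    have zin: "a \<in> set as \<and> b \<in> set bs" if "(a, b) \<in> set (zip as bs)" for a b
      using that set_zip_leftD set_zip_rightD by metis
    have app: "(a \<circ> b) y = (if y \<in> Y then a y else if y \<in> X then b y else y)"
      if "(a, b) \<in> set (zip as bs)" for a b y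
    proof -
      have "a permutes Y" "b permutes (X - Y)" using zin[OF that] pa pb by auto
      then show ?thesis
        using assms(3) permutes_not_in[of b "X - Y" y] permutes_in_image[of b "X - Y" y]
          permutes_not_in[of a Y y] permutes_not_in[of a Y "b y"]
        by (cases "y \<in> Y"; cases "y \<in> X") auto
    qed
    have ra: "map (\<lambda>p. restrict_id p Y) (map2 (\<circ>) as bs) = as"
    proof -
      have "map (\<lambda>p. restrict_id p Y) (map2 (\<circ>) as bs) = map fst (zip as bs)"
        unfolding map_map
      proof (rule map_cong[OF refl])
        fix ab assume "ab \<in> set (zip as bs)"
        moreover obtain a b where "ab = (a, b)" by (cases ab)
        ultimately have ab: "(a, b) \<in> set (zip as bs)" "ab = (a, b)" by auto
        have "restrict_id (a \<circ> b) Y = a"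
        proof
          fix y
          show "restrict_id (a \<circ> b) Y y = a y"
            using app[OF ab(1), of y] permutes_not_in[OF pa, of a y] zin[OF ab(1)] assms(3)
            by (auto simp: restrict_id_def)
        qed
        then show "((\<lambda>p. restrict_id p Y) \<circ> (\<lambda>(a, b). a \<circ> b)) ab = fst ab" using ab(2) by simp
      qed
      then show ?thesis using len by simp
    qed
    moreover have "map (\<lambda>p. restrict_id p (X - Y)) (map2 (\<circ>) as bs) = bs"
    proof -
      have "map (\<lambda>p. restrict_id p (X - Y)) (map2 (\<circ>) as bs) = map snd (zip as bs)"
        unfolding map_map
      proof (rule map_cong[OF refl])
        fix ab assume "ab \<in> set (zip as bs)"
        moreover obtain a b where "ab = (a, b)" by (cases ab)
        ultimately have ab: "(a, b) \<in> set (zip as bs)" "ab = (a, b)" by auto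
        have "restrict_id (a \<circ> b) (X - Y) = b"
        proof
          fix y
          show "restrict_id (a \<circ> b) (X - Y) y = b y"
            using app[OF ab(1), of y] permutes_not_in[OF pb, of b y] zin[OF ab(1)] assms(3)
            by (auto simp: restrict_id_def)
        qed
        then show "((\<lambda>p. restrict_id p (X - Y)) \<circ> (\<lambda>(a, b). a \<circ> b)) ab = snd ab" using ab(2) by simp
      qed
      then show ?thesis using len by simp
    qed
    moreover have "tuple_orbit (map2 (\<circ>) as bs) x = Y"
      using tuple_orbit_map_cong'[of "map2 (\<circ>) as bs" "\<lambda>p. restrict_id p Y" x] ra ac(2) by simp
    moreover have "map2 (\<circ>) as bs \<in> commuting_perms l X"
      unfolding commuting_perms_def
    proof (intro CollectI conjI ballI)
      show "length (map2 (\<circ>) as bs) = l" using len by simp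
      fix p assume "p \<in> set (map2 (\<circ>) as bs)"
      then obtain a b where ab: "(a, b) \<in> set (zip as bs)" "p = a \<circ> b" by auto
      have "a permutes X" "b permutes X"
        using pa pb zin[OF ab(1)] assms(3) by (auto intro: permutes_subset)
      then show "p permutes X" using ab(2) permutes_compose by blast
      fix q assume "q \<in> set (map2 (\<circ>) as bs)"
      then obtain c d where cd: "(c, d) \<in> set (zip as bs)" "q = c \<circ> d" by auto
      have Y: "a y \<in> Y \<and> c y \<in> Y \<and> a (c y) = c (a y)" if "y \<in> Y" for y
        using pa zin[OF ab(1)] zin[OF cd(1)] that commuting_permsD(3)[OF ac(1)]
        by (simp add: permutes_in_image)
      have XY: "b y \<in> X - Y \<and> d y \<in> X - Y \<and> b (d y) = d (b y)" if "y \<in> X - Y" for y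
        using pb[THEN permutes_in_image] zin[OF ab(1)] zin[OF cd(1)] that commuting_permsD(3)[OF bs] by simp
      show "p \<circ> q = q \<circ> p"
      proof
        fix y
        show "(p \<circ> q) y = (q \<circ> p) y"
          using Y[of y] XY[of y] app[OF ab(1), folded ab(2)] app[OF cd(1), folded cd(2)] assms(3)
          by (cases "y \<in> Y"; cases "y \<in> X") auto
      qed
    qed
    ultimately show ?thesis by simp
  qed
  show "\<forall>z\<in>transitive_perms l Y x \<times> commuting_perms l (X - Y).
      ?r (case z of (as, bs) \<Rightarrow> map2 (\<circ>) as bs) = z"
  proof
    fix z assume "z \<in> transitive_perms l Y x \<times> commuting_perms l (X - Y)"
    then obtain as bs where z: "z = (as, bs)" "as \<in> transitive_perms l Y x" "bs \<in> commuting_perms l (X - Y)"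
      by blast
    show "?r (case z of (as, bs) \<Rightarrow> map2 (\<circ>) as bs) = z"
      using main[OF z(2,3)] unfolding z(1) prod.case by (rule conjunct1)
  qed
  show "(\<lambda>(as, bs). map2 (\<circ>) as bs) ` (transitive_perms l Y x \<times> commuting_perms l (X - Y)) \<subseteq> ?S"
  proof (rule image_subsetI)
    fix z assume "z \<in> transitive_perms l Y x \<times> commuting_perms l (X - Y)"
    then obtain as bs where z: "z = (as, bs)" "as \<in> transitive_perms l Y x" "bs \<in> commuting_perms l (X - Y)"
      by blast
    show "(case z of (as, bs) \<Rightarrow> map2 (\<circ>) as bs) \<in> ?S"
      using main[OF z(2,3)] unfolding z(1) prod.case by (rule conjunct2)
  qed
qed

lemma card_commuting_perms_split:
  assumes "finite X" "x \<in> X"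
  shows "card (commuting_perms l X) =
    (\<Sum>Y | x \<in> Y \<and> Y \<subseteq> X. card (transitive_perms l Y x) * card (commuting_perms l (X - Y)))"
proof -
  have "commuting_perms l X = (\<Union>Y\<in>{Y. x \<in> Y \<and> Y \<subseteq> X}. {ps \<in> commuting_perms l X. tuple_orbit ps x = Y})"
  proof (intro equalityI subsetI)
    fix ps assume ps: "ps \<in> commuting_perms l X"
    then have "tuple_orbit ps x \<in> {Y. x \<in> Y \<and> Y \<subseteq> X}"
      using tuple_orbit_subset_perms[OF ps assms(2)] tuple_orbit.base[of x ps] by simp
    with ps show "ps \<in> (\<Union>Y\<in>{Y. x \<in> Y \<and> Y \<subseteq> X}. {ps \<in> commuting_perms l X. tuple_orbit ps x = Y})"
      by blast
  qed blast
  then have "card (commuting_perms l X) =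
      card (\<Union>Y\<in>{Y. x \<in> Y \<and> Y \<subseteq> X}. {ps \<in> commuting_perms l X. tuple_orbit ps x = Y})"
    by (rule arg_cong[where f = card])
  also have "\<dots> = (\<Sum>Y | x \<in> Y \<and> Y \<subseteq> X. card {ps \<in> commuting_perms l X. tuple_orbit ps x = Y})"
    using assms(1) by (intro card_UN_disjoint) (auto simp: finite_commuting_perms)
  also have "\<dots> = (\<Sum>Y | x \<in> Y \<and> Y \<subseteq> X. card (transitive_perms l Y x) * card (commuting_perms l (X - Y)))"
  proof (rule sum.cong[OF refl])
    fix Y assume "Y \<in> {Y. x \<in> Y \<and> Y \<subseteq> X}"
    then have "x \<in> Y" "Y \<subseteq> X" by auto
    from bij_betw_same_card[OF bij_betw_split_tuple[OF assms(1) this]]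
    show "card {ps \<in> commuting_perms l X. tuple_orbit ps x = Y} =
        card (transitive_perms l Y x) * card (commuting_perms l (X - Y))"
      by (simp add: card_cartesian_product)
  qed
  finally show ?thesis .
qed

section \<open>Transitive tuples\<close>

text \<open>The model of a transitive tuple \<open>q # ps\<close>: \<open>m\<close> copies of a \<open>ps\<close>-orbit \<open>Y\<close> on which \<open>ps\<close> acts
  blockwise, while \<open>q\<close> shifts the blocks and closes up by some \<open>g\<close> in the centralizer of \<open>ps\<close>.\<close>

definition lift_perm :: "nat \<Rightarrow> ('a \<Rightarrow> 'a) \<Rightarrow> nat \<times> 'a \<Rightarrow> nat \<times> 'a" where
  "lift_perm m p = (\<lambda>(i, y). if i < m then (i, p y) else (i, y))"

definition shift_perm :: "nat \<Rightarrow> 'a set \<Rightarrow> ('a \<Rightarrow> 'a) \<Rightarrow> nat \<times> 'a \<Rightarrow> nat \<times> 'a" where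
  "shift_perm m Y g = (\<lambda>(i, y). if i < m \<and> y \<in> Y
     then if Suc i < m then (Suc i, y) else (0, g y) else (i, y))"

lemma lift_perm_permutes:
  assumes "finite Y" "p permutes Y"
  shows "lift_perm m p permutes {..<m} \<times> Y"
proof (rule inj_imp_permutes)
  show "inj_on (lift_perm m p) ({..<m} \<times> Y)"
    using permutes_inj[OF assms(2)] by (auto simp: inj_on_def lift_perm_def)
  show "lift_perm m p z = z" if "z \<notin> {..<m} \<times> Y" for z
    using that permutes_not_in[OF assms(2), of "snd z"] by (cases z) (auto simp: lift_perm_def)
qed (use assms in \<open>auto simp: lift_perm_def permutes_in_image\<close>)

lemma shift_perm_permutes:
  assumes "finite Y" "g permutes Y"
  shows "shift_perm m Y g permutes {..<m} \<times> Y"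
proof (rule inj_imp_permutes)
  show "inj_on (shift_perm m Y g) ({..<m} \<times> Y)"
    using permutes_inj[OF assms(2)]
    by (auto simp: inj_on_def shift_perm_def split: if_splits)
qed (use assms in \<open>auto simp: shift_perm_def permutes_in_image split: if_splits\<close>)

text \<open>Moving from one block to the next commutes with a blockwise action by construction. Only
  the closing step applies \<open>g\<close>, and this is where \<open>g\<close> has to centralize
  \<open>ps\<close>.\<close>

lemma model_commuting_perms:
  assumes "finite Y" "ps \<in> commuting_perms l Y" "g permutes Y" "\<And>p. p \<in> set ps \<Longrightarrow> g \<circ> p = p \<circ> g"
  shows "shift_perm m Y g # map (lift_perm m) ps \<in> commuting_perms (Suc l) ({..<m} \<times> Y)"
proof -
  have lift: "lift_perm m p \<circ> lift_perm m q = lift_perm m q \<circ> lift_perm m p"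
    if "p \<in> set ps" "q \<in> set ps" for p q
    using commuting_permsD(3)[OF assms(2) that] by (auto simp: lift_perm_def fun_eq_iff)
  have shift: "shift_perm m Y g \<circ> lift_perm m p = lift_perm m p \<circ> shift_perm m Y g" if "p \<in> set ps" for p
  proof -
    have "p y \<in> Y \<longleftrightarrow> y \<in> Y" for y
      using commuting_permsD(2)[OF assms(2) that] by (rule permutes_in_image)
    moreover have "g (p y) = p (g y)" for y using assms(4)[OF that] by (simp add: fun_eq_iff)
    ultimately show ?thesis by (auto simp: lift_perm_def shift_perm_def fun_eq_iff)
  qed
  show ?thesis
    using lift shift shift[symmetric] lift_perm_permutes[OF assms(1) commuting_permsD(2)[OF assms(2)]]
      shift_perm_permutes[OF assms(1,3)] commuting_permsD(1)[OF assms(2)]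
    unfolding commuting_perms_def by auto
qed

lemma tuple_orbit_lift_perm:
  assumes "0 < m"
  shows "tuple_orbit (map (lift_perm m) ps) (0, x) = Pair 0 ` tuple_orbit ps x" (is "_ = ?R")
proof
  show "tuple_orbit (map (lift_perm m) ps) (0, x) \<subseteq> ?R"
  proof (rule tuple_orbit_subset)
    fix q z assume "q \<in> set (map (lift_perm m) ps)" "z \<in> ?R"
    then obtain p y where p: "p \<in> set ps" "q = lift_perm m p" "y \<in> tuple_orbit ps x" "z = (0, y)"
      by auto
    then show "q z \<in> ?R"
      using tuple_orbit.step[OF p(3,1)] assms by (simp add: lift_perm_def)
  qed (simp add: tuple_orbit.base)
  have "(0, y) \<in> tuple_orbit (map (lift_perm m) ps) (0, x)" if "y \<in> tuple_orbit ps x" for y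
    using that
  proof induction
    case (step y p)
    then show ?case using tuple_orbit.step[OF step(3), of "lift_perm m p"] assms
      by (simp add: lift_perm_def)
  qed (rule tuple_orbit.base)
  then show "?R \<subseteq> tuple_orbit (map (lift_perm m) ps) (0, x)" by blast
qed

lemma model_transitive_perms:
  assumes "finite Y" "x \<in> Y" "0 < m" "ps \<in> transitive_perms l Y x" "g permutes Y"
    and "\<And>p. p \<in> set ps \<Longrightarrow> g \<circ> p = p \<circ> g"
  shows "shift_perm m Y g # map (lift_perm m) ps \<in> transitive_perms (Suc l) ({..<m} \<times> Y) (0, x)"
proof -
  let ?qs = "shift_perm m Y g # map (lift_perm m) ps"
  note ps = transitive_permsD[OF assms(4)]
  have qs: "?qs \<in> commuting_perms (Suc l) ({..<m} \<times> Y)"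
    using assms(1) ps(1) assms(5,6) by (rule model_commuting_perms)
  have sub: "tuple_orbit ?qs (0, x) \<subseteq> {..<m} \<times> Y"
    using assms(2,3) by (intro tuple_orbit_subset_perms[OF qs]) auto
  have "(i, y) \<in> tuple_orbit ?qs (0, x)" if "i < m" "y \<in> Y" for i y
    using that(1)
  proof (induction i)
    case 0
    have "tuple_orbit (map (lift_perm m) ps) (0, x) \<subseteq> tuple_orbit ?qs (0, x)"
      by (rule tuple_orbit_mono) auto
    then show ?case using that(2) ps(2) tuple_orbit_lift_perm[OF assms(3), of ps x] by auto
  next
    case (Suc i)
    then have "(i, y) \<in> tuple_orbit ?qs (0, x)" by simp
    from tuple_orbit.step[OF this, of "shift_perm m Y g"] show ?case
      using Suc.prems that(2) by (simp add: shift_perm_def)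
  qed
  then show ?thesis using sub qs by (auto simp: transitive_perms_def)
qed

text \<open>Here \<open>h\<close> is a choice of coordinates on \<open>X\<close> that identifies
  block 0 with \<open>Y\<close>. The last three conclusions read the data back off the transported
  tuple: \<open>ps\<close> from its action on \<open>Y\<close>, \<open>h\<close> from the powers of
  the shift, and \<open>g x\<close> from the \<open>m\<close>-th power. They make the
  parametrization in \<open>card_block_tuples\<close> injective.\<close>

lemma transported_model:
  fixes h :: "nat \<times> 'a \<Rightarrow> 'a"
  assumes Y: "finite Y" "x \<in> Y" "0 < m" and ps: "ps \<in> transitive_perms l Y x"
    and g: "g permutes Y" "\<forall>p\<in>set ps. g \<circ> p = p \<circ> g"
    and h: "bij_betw h ({..<m} \<times> Y) X" "\<forall>y\<in>Y. h (0, y) = y"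
  defines "T \<equiv> map_permutation ({..<m} \<times> Y) h"
  shows "T (shift_perm m Y g) # map (T \<circ> lift_perm m) ps \<in> transitive_perms (Suc l) X x"
    and "tuple_orbit (map (T \<circ> lift_perm m) ps) x = Y"
    and "\<And>p y. p \<in> set ps \<Longrightarrow> y \<in> Y \<Longrightarrow> (T \<circ> lift_perm m) p y = p y"
    and "\<And>i y. i < m \<Longrightarrow> y \<in> Y \<Longrightarrow> (T (shift_perm m Y g) ^^ i) y = h (i, y)"
    and "(T (shift_perm m Y g) ^^ m) x = g x"
proof -
  let ?D = "{..<m} \<times> Y"
  have inj: "inj_on h ?D" using h(1) by (simp add: bij_betw_def)
  have x: "h (0, x) = x" "(0, x) \<in> ?D" using h(2) Y by auto
  have model: "shift_perm m Y g # map (lift_perm m) ps \<in> transitive_perms (Suc l) ?D (0, x)"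
    using Y ps g(1) by (rule model_transitive_perms) (use g(2) in blast)
  note h = h(1) bspec[OF h(2)]
  show "T (shift_perm m Y g) # map (T \<circ> lift_perm m) ps \<in> transitive_perms (Suc l) X x"
    using map_permutation_transitive_perms[OF h(1) model x(2)] x(1) by (simp add: T_def)
  show *: "(T \<circ> lift_perm m) p y = p y" if "p \<in> set ps" "y \<in> Y" for p y
  proof -
    have "(T \<circ> lift_perm m) p y = T (lift_perm m p) (h (0, y))" using h(2)[OF that(2)] by simp
    also have "\<dots> = h (0, p y)"
      unfolding T_def using map_permutation_apply[OF inj, of "(0, y)"] that(2) Y(3) by (simp add: lift_perm_def)
    finally show ?thesis 
      using h(2)[of "p y"] that(2)
        permutes_in_image[OF commuting_permsD(2)[OF transitive_permsD(1)[OF ps] that(1)], of y] by simp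
  qed
  show "tuple_orbit (map (T \<circ> lift_perm m) ps) x = Y"
    using tuple_orbit_map_cong[of ps x "T \<circ> lift_perm m"] * transitive_permsD(2)[OF ps] by simp
  show Q: "(T (shift_perm m Y g) ^^ i) y = h (i, y)" if "i < m" "y \<in> Y" for i y
    using that(1)
  proof (induction i)
    case (Suc i)
    then have "(T (shift_perm m Y g) ^^ Suc i) y = T (shift_perm m Y g) (h (i, y))" by simp
    also have "\<dots> = h (shift_perm m Y g (i, y))"
      unfolding T_def using map_permutation_apply[OF inj, of "(i, y)"] that Suc.prems by simp
    finally show ?case using Suc.prems that by (simp add: shift_perm_def)
  qed (use h(2) that in simp)
  obtain k where k: "m = Suc k" using Y(3) by (cases m) auto
  have "(T (shift_perm m Y g) ^^ m) x = T (shift_perm m Y g) (h (k, x))"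
    using Q[of k x] Y k by simp
  also have "\<dots> = h (shift_perm m Y g (k, x))"
    unfolding T_def using map_permutation_apply[OF inj, of "(k, x)"] Y k by simp
  also have "\<dots> = g x" using h(2) Y k permutes_in_image[OF g(1)] by (simp add: shift_perm_def)
  finally show "(T (shift_perm m Y g) ^^ m) x = g x" .
qed

lemma funpow_comp_commute:
  assumes "q \<circ> p = p \<circ> q"
  shows "(q ^^ i) (p y) = p ((q ^^ i) y)"
proof (induction i)
  case (Suc i)
  then show ?case using assms by (simp add: fun_eq_iff)
qed simp

text \<open>The number \<open>m\<close> is the first positive time at which \<open>q\<close> brings
  \<open>x\<close> back into \<open>Y\<close>. All points of \<open>Y\<close> return at the same
  times, so the images of \<open>Y\<close> under \<open>q ^^ i\<close> with \<open>i < m\<close> are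
  disjoint and \<open>q ^^ m\<close> preserves \<open>Y\<close>. Their union is closed under all
  entries, hence is all of \<open>X\<close> by transitivity.\<close>

lemma cyclic_block_decomposition:
  assumes X: "finite X" "x \<in> X" and qps: "q # ps \<in> transitive_perms (Suc l) X x"
    and Y: "tuple_orbit ps x = Y"
  obtains m where "0 < m" "bij_betw (\<lambda>(i, y). (q ^^ i) y) ({..<m} \<times> Y) X"
    "bij_betw (q ^^ m) Y Y"
proof -
  note tr = transitive_permsD[OF qps]
  have q: "q permutes X" using tr(1) by (simp add: commuting_perms_def)
  have ps: "ps \<in> commuting_perms l X" using tr(1) by (simp add: commuting_perms_def)
  have comm: "q \<circ> p = p \<circ> q" if "p \<in> set ps" for p
    using commuting_permsD(3)[OF tr(1), of q p] that by (simp add: fun_eq_iff)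
  have YX: "Y \<subseteq> X" using tuple_orbit_subset_perms[OF ps X(2)] Y by simp
  have xY: "x \<in> Y" using Y tuple_orbit.base[of x ps] by simp
  have finY: "finite Y" using YX X(1) finite_subset by blast
  have qi: "(q ^^ i) permutes X" for i
  proof (induction i)
    case (Suc i)
    show ?case unfolding funpow.simps(2) using permutes_compose[OF Suc q] .
  qed (simp only: funpow.simps permutes_id)
  \<comment> \<open>Return times do not depend on the point: some \<open>g\<close> preserving
    \<open>Y\<close> takes \<open>x\<close> to \<open>y\<close> and commutes with every power of
    \<open>q\<close>.\<close>
  have iff: "(q ^^ r) y \<in> Y \<longleftrightarrow> (q ^^ r) x \<in> Y" if yY: "y \<in> Y" for r y
  proof -
    obtain g where g: "g x = y" "g permutes X" "bij_betw g Y Y"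
      "\<And>h. (\<forall>p\<in>set ps. h \<circ> p = p \<circ> h) \<Longrightarrow> h \<circ> g = g \<circ> h"
      using tuple_orbit_centralizer[OF ps X, of y, unfolded Y, OF yY] by blast
    have "(q ^^ r) \<circ> p = p \<circ> (q ^^ r)" if "p \<in> set ps" for p
      using funpow_comp_commute[OF comm[OF that]] by (simp add: fun_eq_iff)
    then have "(q ^^ r) \<circ> g = g \<circ> (q ^^ r)" using g(4) by blast
    then have "(q ^^ r) y = g ((q ^^ r) x)" using g(1) by (auto simp: fun_eq_iff)
    moreover have "g z \<in> Y \<longleftrightarrow> z \<in> Y" for z
      using inj_image_mem_iff[OF permutes_inj[OF g(2)], of z Y] bij_betw_imp_surj_on[OF g(3)] by simp
    ultimately show ?thesis by simp
  qed
  define m where "m = (LEAST m. 0 < m \<and> (q ^^ m) x \<in> Y)"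
  have "permutation q" using q X(1) by (auto simp: permutation_permutes)
  then obtain n where "q ^^ n = id" "0 < n" by (rule permutation_is_nilpotent)
  then have "0 < n \<and> (q ^^ n) x \<in> Y" using xY by simp
  then have "0 < m \<and> (q ^^ m) x \<in> Y" unfolding m_def by (rule LeastI)
  then have m: "0 < m" "(q ^^ m) x \<in> Y" by auto
  have least: "m \<le> r" if "0 < r" "(q ^^ r) x \<in> Y" for r
    unfolding m_def by (rule Least_le) (use that in simp)
  let ?h = "\<lambda>(i, y). (q ^^ i) y"
  have le: "i = j \<and> y = y'" if "i \<le> j" "j < m" "y \<in> Y" "y' \<in> Y" "(q ^^ i) y = (q ^^ j) y'" for i j y y'
  proof -
    have "(q ^^ j) y' = (q ^^ i) ((q ^^ (j - i)) y')"
      using that(1) by (metis comp_apply funpow_add le_add_diff_inverse)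
    then have y: "y = (q ^^ (j - i)) y'" using that(5) injD[OF permutes_inj[OF qi[of i]]] by simp
    then have "(q ^^ (j - i)) x \<in> Y" using iff[OF that(4), of "j - i"] that(3) by simp
    then have "j - i = 0" using least[of "j - i"] that(2) by linarith
    then show ?thesis using y that(1) by simp
  qed
  have "inj_on ?h ({..<m} \<times> Y)"
  proof (rule inj_onI, clarsimp)
    fix i y j y' assume "i < m" "y \<in> Y" "j < m" "y' \<in> Y" "(q ^^ i) y = (q ^^ j) y'"
    then show "i = j \<and> y = y'" using le[of i j y y'] le[of j i y' y] by (cases "i \<le> j") auto
  qed
  moreover have "?h ` ({..<m} \<times> Y) = X"
  proof
    show "?h ` ({..<m} \<times> Y) \<subseteq> X"
    proof (rule image_subsetI)
      fix z assume "z \<in> {..<m} \<times> Y"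
      then show "?h z \<in> X" using YX permutes_in_image[OF qi[of "fst z"], of "snd z"] by (cases z) auto
    qed
    have "tuple_orbit (q # ps) x \<subseteq> ?h ` ({..<m} \<times> Y)"
    proof (rule tuple_orbit_subset)
      show "x \<in> ?h ` ({..<m} \<times> Y)" using m(1) xY by (intro rev_image_eqI[of "(0, x)"]) auto
      fix p z assume p: "p \<in> set (q # ps)" and "z \<in> ?h ` ({..<m} \<times> Y)"
      then obtain i y where z: "i < m" "y \<in> Y" "z = (q ^^ i) y" by auto
      show "p z \<in> ?h ` ({..<m} \<times> Y)"
      proof (cases "p \<in> set ps")
        case True
        then have "p z = (q ^^ i) (p y)" using funpow_comp_commute[OF comm[OF True]] z(3) by simp
        moreover have "p y \<in> Y" using tuple_orbit.step[of y ps x p] True z(2) Y by simp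
        ultimately show ?thesis using z(1) by (intro rev_image_eqI[of "(i, p y)"]) auto
      next
        case False
        then have pz: "p z = (q ^^ Suc i) y" using p z(3) by simp
        show ?thesis
        proof (cases "Suc i = m")
          case True
          then have "p z \<in> Y" using pz iff[OF z(2), of m] m(2) by simp
          then show ?thesis using m(1) by (intro rev_image_eqI[of "(0, p z)"]) auto
        next
          case False
          then show ?thesis using pz z by (intro rev_image_eqI[of "(Suc i, y)"]) auto
        qed
      qed
    qed
    then show "X \<subseteq> ?h ` ({..<m} \<times> Y)" using tr(2) by simp
  qed
  ultimately have "bij_betw ?h ({..<m} \<times> Y) X" by (simp add: bij_betw_def)
  moreover have "bij_betw (q ^^ m) Y Y"
  proof -
    have "(q ^^ m) ` Y \<subseteq> Y" using iff[where r = m] m(2) by (intro image_subsetI) simp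
    moreover have "inj_on (q ^^ m) Y" using permutes_inj_on[OF qi] .
    ultimately show ?thesis using finY by (simp add: bij_betw_def endo_inj_surj)
  qed
  ultimately show ?thesis using m(1) that by blast
qed

text \<open>In the coordinates \<open>(i, y)\<close> standing for \<open>(q ^^ i) y\<close>, the map
  \<open>q\<close> is a shift that closes up by \<open>q ^^ m\<close>. The entries of
  \<open>ps\<close> commute with \<open>q\<close> and therefore act alike in every block. So each
  transitive tuple arises from a model.\<close>

lemma map_permutation_model_eq:
  assumes X: "finite X" "x \<in> X" and qps: "q # ps \<in> transitive_perms (Suc l) X x"
    and Y: "tuple_orbit ps x = Y"
    and h: "0 < m" "bij_betw (\<lambda>(i, y). (q ^^ i) y) ({..<m} \<times> Y) X"
  defines "T \<equiv> map_permutation ({..<m} \<times> Y) (\<lambda>(i, y). (q ^^ i) y)"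
  shows "T (shift_perm m Y (restrict_id (q ^^ m) Y)) = q"
    and "p \<in> set ps \<Longrightarrow> T (lift_perm m (restrict_id p Y)) = p"
proof -
  let ?h = "\<lambda>(i, y). (q ^^ i) y"
  note tr = transitive_permsD[OF qps]
  have q: "q permutes X" using tr(1) by (simp add: commuting_perms_def)
  have inj: "inj_on ?h ({..<m} \<times> Y)" and im: "?h ` ({..<m} \<times> Y) = X"
    using h(2) by (auto simp: bij_betw_def)
  have eqI: "T f = p"
    if p: "p permutes X" and f: "\<And>i y. i < m \<Longrightarrow> y \<in> Y \<Longrightarrow> ?h (f (i, y)) = p ((q ^^ i) y)" for f p
  proof
    fix z
    show "T f z = p z"
    proof (cases "z \<in> X")
      case True
      then have "z \<in> ?h ` ({..<m} \<times> Y)" by (simp only: im)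
      then obtain i y where z: "i < m" "y \<in> Y" "z = ?h (i, y)" by auto
      have "T f z = ?h (f (i, y))"
        unfolding T_def z(3) by (rule map_permutation_apply[OF inj]) (use z in simp)
      also have "\<dots> = p z" using f[OF z(1,2)] z(3) by simp
      finally show ?thesis .
    next
      case False
      then show ?thesis unfolding T_def map_permutation_def im using permutes_not_in[OF p False] by simp
    qed
  qed
  show "T (shift_perm m Y (restrict_id (q ^^ m) Y)) = q"
  proof (rule eqI[OF q])
    fix i y assume iy: "i < m" "y \<in> Y"
    show "?h (shift_perm m Y (restrict_id (q ^^ m) Y) (i, y)) = q ((q ^^ i) y)"
    proof (cases "Suc i = m")
      case True
      have "shift_perm m Y (restrict_id (q ^^ m) Y) (i, y) = (0, (q ^^ m) y)"
        using True iy by (simp add: shift_perm_def)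
      then show ?thesis unfolding True[symmetric] by simp
    next
      case False
      then have "shift_perm m Y (restrict_id (q ^^ m) Y) (i, y) = (Suc i, y)"
        using iy by (simp add: shift_perm_def)
      then show ?thesis by simp
    qed
  qed
  assume p: "p \<in> set ps"
  have "q \<circ> p = p \<circ> q" using commuting_permsD(3)[OF tr(1), of q p] p by (simp add: fun_eq_iff)
  note comm = funpow_comp_commute[OF this]
  have "p permutes X" using commuting_permsD(2)[OF tr(1), of p] p by simp
  then show "T (lift_perm m (restrict_id p Y)) = p"
  proof (rule eqI)
    fix i y assume "i < m" "y \<in> Y"
    then have "lift_perm m (restrict_id p Y) (i, y) = (i, p y)" by (simp add: lift_perm_def)
    then show "?h (lift_perm m (restrict_id p Y) (i, y)) = p ((q ^^ i) y)" using comm[of i y] by simp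
  qed
qed

text \<open>Fixed reference coordinates. Any others that agree on block 0 differ by a permutation of
  \<open>X - Y\<close>, the source of the factorial in \<open>card_block_tuples\<close>.\<close>

lemma ex_block_coordinates:
  assumes "finite X" "Y \<subseteq> X" "0 < m" "card X = m * card Y"
  shows "\<exists>e. bij_betw e ({..<m} \<times> Y) X \<and> (\<forall>y\<in>Y. e (0, y) = y)"
proof -
  have fin: "finite Y" using assms(1,2) finite_subset by blast
  have "card ({1..<m} \<times> Y) = card (X - Y)"
    using assms fin by (simp add: card_cartesian_product card_Diff_subset diff_mult_distrib)
  then obtain f where f: "bij_betw f ({1..<m} \<times> Y) (X - Y)"
    using finite_same_card_bij[of "{1..<m} \<times> Y" "X - Y"] assms(1) fin by auto
  let ?e = "\<lambda>z. if fst z = 0 then snd z else f z"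
  have D: "{..<m} \<times> Y = {0} \<times> Y \<union> {1..<m} \<times> Y" using assms(3) by auto
  have "bij_betw ?e ({0} \<times> Y) Y" by (rule bij_betw_byWitness[where f' = "Pair 0"]) auto
  moreover have "bij_betw ?e ({1..<m} \<times> Y) (X - Y)"
    using f by (rule bij_betw_cong[THEN iffD1, rotated]) auto
  ultimately have "bij_betw ?e ({0} \<times> Y \<union> {1..<m} \<times> Y) (Y \<union> (X - Y))"
    by (rule bij_betw_combine) auto
  then have "bij_betw ?e ({..<m} \<times> Y) X" using assms(2) D by (simp add: Un_absorb1)
  then show ?thesis by (intro exI[of _ ?e]) simp
qed

text \<open>Existence: the words in \<open>ps\<close> centralize \<open>ps\<close> because the
  entries commute, and they reach every point of \<open>Y\<close>. Uniqueness: an equivariant map is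
  determined by its value at \<open>x\<close>. A closing element is thus the same as a point
  \<open>z\<close> of \<open>Y\<close>.\<close>

lemma transitive_centralizer:
  assumes "finite Y" "x \<in> Y" "ps \<in> transitive_perms l Y x" "z \<in> Y"
  shows "\<exists>!g. g x = z \<and> g permutes Y \<and> (\<forall>p\<in>set ps. g \<circ> p = p \<circ> g)"
proof (rule ex_ex1I)
  note ps = transitive_permsD[OF assms(3)]
  obtain g where g: "g x = z" "g permutes Y" "\<And>h. (\<forall>p\<in>set ps. h \<circ> p = p \<circ> h) \<Longrightarrow> h \<circ> g = g \<circ> h"
    using tuple_orbit_centralizer[OF ps(1) assms(1,2), of z, unfolded ps(2), OF assms(4)] by blast
  have "g \<circ> p = p \<circ> g" if "p \<in> set ps" for p
  proof -
    have "p \<circ> q = q \<circ> p" if "q \<in> set ps" for q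
      using commuting_permsD(3)[OF ps(1) \<open>p \<in> set ps\<close> that] by (simp add: fun_eq_iff)
    then show ?thesis using g(3)[of p] by simp
  qed
  with g(1,2) show "\<exists>g. g x = z \<and> g permutes Y \<and> (\<forall>p\<in>set ps. g \<circ> p = p \<circ> g)" by blast
  fix g h assume gh: "g x = z \<and> g permutes Y \<and> (\<forall>p\<in>set ps. g \<circ> p = p \<circ> g)"
    "h x = z \<and> h permutes Y \<and> (\<forall>p\<in>set ps. h \<circ> p = p \<circ> h)"
  show "g = h"
  proof
    fix y
    show "g y = h y"
    proof (cases "y \<in> Y")
      case True
      then have "y \<in> tuple_orbit ps x" using ps(2) by simp
      then show ?thesis
      proof (rule tuple_orbit_eqI[where f = "\<lambda>p. p"])
        show "g (p y) = p (g y)" "h (p y) = p (h y)" if "p \<in> set ps" for p y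
          using gh that by (simp_all add: fun_eq_iff)
      qed (use gh in simp)
    next
      case False
      then show ?thesis using gh permutes_not_in[of g Y y] permutes_not_in[of h Y y] by simp
    qed
  qed
qed

text \<open>The three factors count independent parameters: the tuple \<open>ps\<close> on
  \<open>Y\<close>, the point \<open>z\<close> to which the closing element sends \<open>x\<close>,
  and the permutation \<open>\<sigma>\<close> of \<open>X - Y\<close> that turns the reference
  coordinates \<open>e\<close> into those given by the powers of \<open>q\<close>.\<close>

lemma card_block_tuples:
  fixes X :: "'a set"
  assumes X: "finite X" "x \<in> Y" "Y \<subseteq> X" and m: "0 < m" "card X = m * card Y"
  shows "card {qs \<in> transitive_perms (Suc l) X x. tuple_orbit (tl qs) x = Y} =
    card (transitive_perms l Y x) * (card Y * fact (card X - card Y))"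
proof -
  have fin: "finite Y" using X(1,3) finite_subset by blast
  have xX: "x \<in> X" using X by blast
  let ?D = "{..<m} \<times> Y"
  obtain e where e: "bij_betw e ?D X" "\<And>y. y \<in> Y \<Longrightarrow> e (0, y) = y"
    using ex_block_coordinates[OF X(1,3) m] by blast
  define c where "c ps z = (THE g. g x = z \<and> g permutes Y \<and> (\<forall>p\<in>set ps. g \<circ> p = p \<circ> g))" for ps z
  have c: "c ps z x = z \<and> c ps z permutes Y \<and> (\<forall>p\<in>set ps. c ps z \<circ> p = p \<circ> c ps z)"
    if "ps \<in> transitive_perms l Y x" "z \<in> Y" for ps z
    using theI'[OF transitive_centralizer[OF fin X(2) that]] unfolding c_def .
  define F where "F = (\<lambda>(ps, z, \<sigma> :: 'a \<Rightarrow> 'a).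
    map_permutation ?D (\<sigma> \<circ> e) (shift_perm m Y (c ps z)) #
    map (map_permutation ?D (\<sigma> \<circ> e) \<circ> lift_perm m) ps)"
  let ?A = "transitive_perms l Y x \<times> Y \<times> {\<sigma>. \<sigma> permutes (X - Y)}"
  let ?B = "{qs \<in> transitive_perms (Suc l) X x. tuple_orbit (tl qs) x = Y}"
  have bij: "bij_betw (\<sigma> \<circ> e) ?D X" "\<forall>y\<in>Y. (\<sigma> \<circ> e) (0, y) = y"
    if "\<sigma> permutes (X - Y)" for \<sigma>
  proof -
    have "\<sigma> permutes X" using that by (rule permutes_subset) auto
    then show "bij_betw (\<sigma> \<circ> e) ?D X" using bij_betw_trans[OF e(1) permutes_imp_bij] by blast
    show "\<forall>y\<in>Y. (\<sigma> \<circ> e) (0, y) = y"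
      using e(2) permutes_not_in[OF that] by simp
  qed
  have "inj_on F ?A"
  proof (rule inj_onI)
    fix a b assume ab: "a \<in> ?A" "b \<in> ?A" "F a = F b"
    obtain ps z \<sigma> ps' z' \<sigma>' where abd: "a = (ps, z, \<sigma>)" "b = (ps', z', \<sigma>')"
      by (cases a, cases b)
    have 1: "ps \<in> transitive_perms l Y x" "z \<in> Y" "\<sigma> permutes (X - Y)"
      and 2: "ps' \<in> transitive_perms l Y x" "z' \<in> Y" "\<sigma>' permutes (X - Y)"
      and eq: "F (ps, z, \<sigma>) = F (ps', z', \<sigma>')"
      using ab unfolding abd by auto
    note c1 = c[OF 1(1,2)] and c2 = c[OF 2(1,2)]
    note t1 = transported_model[OF fin X(2) m(1) 1(1) conjunct1[OF conjunct2[OF c1]]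
        conjunct2[OF conjunct2[OF c1]] bij[OF 1(3)]]
    note t2 = transported_model[OF fin X(2) m(1) 2(1) conjunct1[OF conjunct2[OF c2]]
        conjunct2[OF conjunct2[OF c2]] bij[OF 2(3)]]
    have hd: "map_permutation ?D (\<sigma> \<circ> e) (shift_perm m Y (c ps z)) =
        map_permutation ?D (\<sigma>' \<circ> e) (shift_perm m Y (c ps' z'))"
      and tl: "map (map_permutation ?D (\<sigma> \<circ> e) \<circ> lift_perm m) ps =
        map (map_permutation ?D (\<sigma>' \<circ> e) \<circ> lift_perm m) ps'"
      using eq unfolding F_def by auto
    have z: "z = z'"
    proof -
      have "c ps z x = c ps' z' x"
        using t1(5)[symmetric] unfolding hd by (rule trans) (rule t2(5))
      then show ?thesis using c1 c2 by simp
    qed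
    have len: "length ps = length ps'" using tl by (rule map_eq_imp_length_eq)
    have ps: "ps = ps'"
    proof (rule nth_equalityI[OF len])
      fix i assume i: "i < length ps"
      then have *: "(map_permutation ?D (\<sigma> \<circ> e) \<circ> lift_perm m) (ps ! i) =
          (map_permutation ?D (\<sigma>' \<circ> e) \<circ> lift_perm m) (ps' ! i)"
        using tl len by (metis nth_map)
      have in1: "ps ! i \<in> set ps" "ps' ! i \<in> set ps'" using i len by auto
      show "ps ! i = ps' ! i"
      proof
        fix y
        show "(ps ! i) y = (ps' ! i) y"
        proof (cases "y \<in> Y")
          case True
          show ?thesis
            using t1(3)[OF in1(1) True, symmetric] unfolding * by (rule trans) (rule t2(3)[OF in1(2) True])
        next
          case False
          then show ?thesis
            using permutes_not_in[OF commuting_permsD(2)[OF transitive_permsD(1)[OF 1(1)] in1(1)] False]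
              permutes_not_in[OF commuting_permsD(2)[OF transitive_permsD(1)[OF 2(1)] in1(2)] False] by simp
        qed
      qed
    qed
    have "\<sigma> = \<sigma>'"
    proof
      fix w
      show "\<sigma> w = \<sigma>' w"
      proof (cases "w \<in> X")
        case True
        then have "w \<in> e ` ?D" using e(1) by (simp add: bij_betw_def)
        then obtain i y where iy: "i < m" "y \<in> Y" "w = e (i, y)" by auto
        have "(\<sigma> \<circ> e) (i, y) = (\<sigma>' \<circ> e) (i, y)"
          using t1(4)[OF iy(1,2), symmetric] unfolding hd by (rule trans) (rule t2(4)[OF iy(1,2)])
        then show ?thesis using iy(3) by simp
      next
        case False
        then show ?thesis using permutes_not_in[OF 1(3), of w] permutes_not_in[OF 2(3), of w] by simp
      qed
    qed
    with z ps show "a = b" unfolding abd by simp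
  qed
  moreover have "F ` ?A = ?B"
  proof
    show "F ` ?A \<subseteq> ?B"
    proof (rule image_subsetI)
      fix a assume "a \<in> ?A"
      then obtain ps z \<sigma> where a: "a = (ps, z, \<sigma>)"
        and 1: "ps \<in> transitive_perms l Y x" "z \<in> Y" "\<sigma> permutes (X - Y)" by auto
      note c1 = c[OF 1(1,2)]
      note t1 = transported_model[OF fin X(2) m(1) 1(1) conjunct1[OF conjunct2[OF c1]]
        conjunct2[OF conjunct2[OF c1]] bij[OF 1(3)]]
      show "F a \<in> ?B" using t1(1,2) unfolding F_def a prod.case comp_def by simp
    qed
    show "?B \<subseteq> F ` ?A"
    proof
      fix qs assume qs: "qs \<in> ?B"
      then have tr: "qs \<in> transitive_perms (Suc l) X x" and Y: "tuple_orbit (tl qs) x = Y" by auto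
      have "length qs = Suc l" using commuting_permsD(1)[OF transitive_permsD(1)[OF tr]] .
      then obtain q ps where qps: "qs = q # ps" by (cases qs) auto
      note tr = tr[unfolded qps] and Y = Y[unfolded qps list.sel]
      let ?h = "\<lambda>(i, y). (q ^^ i) y"
      obtain m' where m': "0 < m'" "bij_betw ?h ({..<m'} \<times> Y) X" "bij_betw (q ^^ m') Y Y"
        using cyclic_block_decomposition[OF X(1) xX tr Y] .
      have "m' * card Y = m * card Y"
        using bij_betw_same_card[OF m'(2)] m(2) by (simp add: card_cartesian_product)
      then have "m' = m" using fin X(2) by auto
      note h = m'(2)[unfolded this] and qm = m'(3)[unfolded this]
      define ps' where "ps' = map (\<lambda>p. restrict_id p Y) ps"
      \<comment> \<open>Change from the reference coordinates to those defined by \<open>q\<close>.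
        Both are the identity on block 0, so \<open>\<sigma>\<close> fixes \<open>Y\<close>
        pointwise.\<close>
      define \<sigma> where "\<sigma> = restrict_id (?h \<circ> inv_into ?D e) X"
      let ?g = "restrict_id (q ^^ m) Y"
      have psc: "ps \<in> commuting_perms l X"
        using transitive_permsD(1)[OF tr] by (simp add: commuting_perms_def)
      have "tuple_orbit ps' x = Y"
        unfolding ps'_def using Y by (subst tuple_orbit_map_cong) auto
      moreover have "ps' \<in> commuting_perms l Y"
        unfolding ps'_def using bij_betw_tuple_orbit[OF psc X(1) xX] Y
        by (intro restrict_id_commuting_perms[OF psc]) simp
      ultimately have ps': "ps' \<in> transitive_perms l Y x" by (simp add: transitive_perms_def)
      have z: "?g x \<in> Y" using qm X(2) by (auto simp: bij_betw_def)
      have gperm: "?g permutes Y" using qm by (rule permutes_restrict_id)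
      have gcomm: "?g \<circ> p' = p' \<circ> ?g" if p': "p' \<in> set ps'" for p'
      proof -
        obtain p where p: "p \<in> set ps" "p' = restrict_id p Y" using p' by (auto simp: ps'_def)
        have "q \<circ> p = p \<circ> q"
          using commuting_permsD(3)[OF transitive_permsD(1)[OF tr], of q p] p(1) by (simp add: fun_eq_iff)
        note qp = funpow_comp_commute[OF this, of m]
        have "bij_betw p Y Y" using bij_betw_tuple_orbit[OF psc X(1) xX p(1)] Y by simp
        then have "p y \<in> Y" if "y \<in> Y" for y using that by (auto simp: bij_betw_def)
        moreover have "(q ^^ m) y \<in> Y" if "y \<in> Y" for y using qm that by (auto simp: bij_betw_def)
        ultimately show ?thesis using qp unfolding p(2) by (auto simp: fun_eq_iff restrict_id_def)
      qed
      have cg: "c ps' (?g x) = ?g"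
        using transitive_centralizer[OF fin X(2) ps' z] c[OF ps' z] gperm gcomm by blast
      have \<sigma>e: "\<sigma> (e w) = ?h w" if "w \<in> ?D" for w
        unfolding \<sigma>_def using e(1) that bij_betw_inv_into_left[OF e(1) that] by (auto simp: bij_betw_def)
      have \<sigma>: "\<sigma> permutes (X - Y)"
      proof (rule permutes_superset)
        show "\<sigma> permutes X" unfolding \<sigma>_def
          by (rule permutes_restrict_id) (rule bij_betw_trans[OF bij_betw_inv_into[OF e(1)] h])
        fix y assume "y \<in> X - (X - Y)"
        then have "y \<in> Y" by simp
        then show "\<sigma> y = y" using \<sigma>e[of "(0, y)"] e(2)[of y] m(1) by simp
      qed
      have cong: "map_permutation ?D (\<sigma> \<circ> e) f = map_permutation ?D ?h f" if "f permutes ?D" for f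
        using bij(1)[OF \<sigma>] that \<sigma>e by (intro map_permutation_cong) (auto simp: bij_betw_def)
      have "F (ps', ?g x, \<sigma>) = qs"
      proof -
        have "map_permutation ?D (\<sigma> \<circ> e) (shift_perm m Y ?g) = q"
          using cong[OF shift_perm_permutes[OF fin gperm]] map_permutation_model_eq(1)[OF X(1) xX tr Y m(1) h]
          by simp
        moreover have "map (map_permutation ?D (\<sigma> \<circ> e) \<circ> lift_perm m) ps' = ps"
          unfolding ps'_def map_map
        proof (rule map_idI)
          fix p assume p: "p \<in> set ps"
          have "bij_betw p Y Y" using bij_betw_tuple_orbit[OF psc X(1) xX p] Y by simp
          then have "restrict_id p Y permutes Y" by (rule permutes_restrict_id)
          from cong[OF lift_perm_permutes[OF fin this]] map_permutation_model_eq(2)[OF X(1) xX tr Y m(1) h p]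
          show "((map_permutation ?D (\<sigma> \<circ> e) \<circ> lift_perm m) \<circ> (\<lambda>p. restrict_id p Y)) p = p" by simp
        qed
        ultimately show ?thesis unfolding F_def prod.case cg qps by simp
      qed
      moreover have "(ps', ?g x, \<sigma>) \<in> ?A" using ps' z \<sigma> by simp
      ultimately show "qs \<in> F ` ?A" by (rule image_eqI[OF sym])
    qed
  qed
  ultimately have "card ?B = card ?A" using card_image[of F ?A] by simp
  also have "card ?A = card (transitive_perms l Y x) * (card Y * fact (card X - card Y))"
    using X fin by (simp add: card_cartesian_product card_permutations[OF refl] card_Diff_subset)
  finally show ?thesis .
qed

section \<open>Recurrences\<close>

lemma sum_pointed_subsets:
  fixes f :: "nat \<Rightarrow> 'b::comm_semiring_1"
  assumes "finite X" "x \<in> X"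
  shows "(\<Sum>Y | x \<in> Y \<and> Y \<subseteq> X. f (card Y)) =
    (\<Sum>k=1..card X. of_nat ((card X - 1) choose (k - 1)) * f k)"
proof -
  let ?S = "{Y. x \<in> Y \<and> Y \<subseteq> X}"
  have fin: "finite ?S" using assms(1) by simp
  have card: "card {Y \<in> ?S. card Y = k} = (card X - 1) choose (k - 1)" if "1 \<le> k" for k
  proof -
    have "bij_betw (insert x) {B. B \<subseteq> X - {x} \<and> card B = k - 1} {Y \<in> ?S. card Y = k}"
    proof (rule bij_betw_byWitness[where f' = "\<lambda>Y. Y - {x}"])
      show "insert x ` {B. B \<subseteq> X - {x} \<and> card B = k - 1} \<subseteq> {Y \<in> ?S. card Y = k}"
      proof (rule image_subsetI)
        fix B assume B: "B \<in> {B. B \<subseteq> X - {x} \<and> card B = k - 1}"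
        then have "finite B" "x \<notin> B" using assms(1) finite_subset by auto
        then show "insert x B \<in> {Y \<in> ?S. card Y = k}" using B assms(2) that by auto
      qed
      show "(\<lambda>Y. Y - {x}) ` {Y \<in> ?S. card Y = k} \<subseteq> {B. B \<subseteq> X - {x} \<and> card B = k - 1}"
        using assms(1) finite_subset by (auto simp: card_Diff_singleton)
    qed auto
    from bij_betw_same_card[OF this] show ?thesis
      using n_subsets[of "X - {x}" "k - 1"] assms by simp
  qed
  have "(\<Sum>Y\<in>?S. f (card Y)) = (\<Sum>k=1..card X. \<Sum>Y\<in>{Y \<in> ?S. card Y = k}. f (card Y))"
  proof (rule sum.group[symmetric, OF fin])
    show "card ` ?S \<subseteq> {1..card X}"
    proof (rule image_subsetI)
      fix Y assume Y: "Y \<in> ?S"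
      then have "finite Y" using assms(1) finite_subset by blast
      then have "0 < card Y" using Y card_gt_0_iff by blast
      then show "card Y \<in> {1..card X}" using Y card_mono[OF assms(1), of Y] by simp
    qed
  qed simp
  also have "\<dots> = (\<Sum>k=1..card X. of_nat ((card X - 1) choose (k - 1)) * f k)"
  proof (rule sum.cong[OF refl])
    fix k assume "k \<in> {1..card X}"
    then have "1 \<le> k" by simp
    have "(\<Sum>Y\<in>{Y \<in> ?S. card Y = k}. f (card Y)) = (\<Sum>Y\<in>{Y \<in> ?S. card Y = k}. f k)"
      by (rule sum.cong) auto
    then show "(\<Sum>Y\<in>{Y \<in> ?S. card Y = k}. f (card Y)) = of_nat ((card X - 1) choose (k - 1)) * f k"
      unfolding card[OF \<open>1 \<le> k\<close>, symmetric] by simp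
  qed
  finally show ?thesis .
qed

definition num_commuting :: "nat \<Rightarrow> nat \<Rightarrow> nat" where
  "num_commuting l n = card (commuting_perms l {..<n})"

definition num_transitive :: "nat \<Rightarrow> nat \<Rightarrow> nat" where
  "num_transitive l k = card (transitive_perms l {..<k} 0)"

lemma card_commuting_perms: "finite X \<Longrightarrow> card (commuting_perms l X) = num_commuting l (card X)"
  unfolding num_commuting_def by (rule card_commuting_perms_cong) auto

lemma card_transitive_perms:
  assumes "finite X" "x \<in> X"
  shows "card (transitive_perms l X x) = num_transitive l (card X)"
proof -
  have "0 < card X" using assms card_gt_0_iff by blast
  then show ?thesis unfolding num_transitive_def
    using assms by (intro card_transitive_perms_cong) auto
qed

lemma num_commuting_rec:
  assumes "1 \<le> n"
  shows "num_commuting l n =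
    (\<Sum>k=1..n. ((n - 1) choose (k - 1)) * (num_transitive l k * num_commuting l (n - k)))"
proof -
  have "num_commuting l n = (\<Sum>Y | 0 \<in> Y \<and> Y \<subseteq> {..<n}.
      card (transitive_perms l Y 0) * card (commuting_perms l ({..<n} - Y)))"
    unfolding num_commuting_def using assms by (intro card_commuting_perms_split) auto
  also have "\<dots> = (\<Sum>Y | 0 \<in> Y \<and> Y \<subseteq> {..<n}. num_transitive l (card Y) * num_commuting l (n - card Y))"
  proof (rule sum.cong[OF refl])
    fix Y assume "Y \<in> {Y. 0 \<in> Y \<and> Y \<subseteq> {..<n}}"
    then have Y: "0 \<in> Y" "Y \<subseteq> {..<n}" "finite Y" using finite_subset by auto
    then have "card ({..<n} - Y) = n - card Y" by (simp add: card_Diff_subset)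
    then show "card (transitive_perms l Y 0) * card (commuting_perms l ({..<n} - Y)) =
        num_transitive l (card Y) * num_commuting l (n - card Y)"
      using card_transitive_perms[OF Y(3,1)] card_commuting_perms[of "{..<n} - Y"] by simp
  qed
  also have "\<dots> = (\<Sum>k=1..n. ((n - 1) choose (k - 1)) * (num_transitive l k * num_commuting l (n - k)))"
    using sum_pointed_subsets[of "{..<n}" 0 "\<lambda>d. num_transitive l d * num_commuting l (n - d)"] assms by simp
  finally show ?thesis .
qed

lemma num_transitive_Suc:
  assumes "1 \<le> k"
  shows "num_transitive (Suc l) k =
    (\<Sum>d=1..k. ((k - 1) choose (d - 1)) * (if d dvd k then num_transitive l d * (d * fact (k - d)) else 0))"
proof -
  let ?X = "{..<k}"
  let ?S = "{Y. (0::nat) \<in> Y \<and> Y \<subseteq> ?X}"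
  let ?B = "\<lambda>Y. {qs \<in> transitive_perms (Suc l) ?X 0. tuple_orbit (tl qs) 0 = Y}"
  let ?f = "\<lambda>d. if d dvd k then num_transitive l d * (d * fact (k - d)) else 0"
  have k: "0 \<in> ?X" using assms by simp
  have "transitive_perms (Suc l) ?X 0 = (\<Union>Y\<in>?S. ?B Y)"
  proof (intro equalityI subsetI)
    fix qs assume qs: "qs \<in> transitive_perms (Suc l) ?X 0"
    have "set (tl qs) \<subseteq> set qs" by (cases qs) auto
    then have "tuple_orbit (tl qs) 0 \<subseteq> ?X"
      using tuple_orbit_mono[of "tl qs" qs 0] transitive_permsD(2)[OF qs] by simp
    then have "tuple_orbit (tl qs) 0 \<in> ?S" using tuple_orbit.base[of 0 "tl qs"] by simp
    with qs show "qs \<in> (\<Union>Y\<in>?S. ?B Y)" by blast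
  qed blast
  then have "num_transitive (Suc l) k = card (\<Union>Y\<in>?S. ?B Y)"
    unfolding num_transitive_def by (rule arg_cong[where f = card])
  also have "\<dots> = (\<Sum>Y\<in>?S. card (?B Y))"
    by (rule card_UN_disjoint) (auto simp: finite_transitive_perms)
  also have "\<dots> = (\<Sum>Y\<in>?S. ?f (card Y))"
  proof (rule sum.cong[OF refl])
    fix Y assume "Y \<in> ?S"
    then have Y: "0 \<in> Y" "Y \<subseteq> ?X" "finite Y" using finite_subset by auto
    show "card (?B Y) = ?f (card Y)"
    proof (cases "card Y dvd k")
      case True
      then obtain m where m: "k = m * card Y" by (metis dvd_div_mult_self)
      then have "0 < m" using assms by (cases m) auto
      then show ?thesis
        using card_block_tuples[of ?X 0 Y m l] m True Y card_transitive_perms[OF Y(3,1)] by simp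
    next
      case False
      \<comment> \<open>The blocks of a transitive tuple have equal size, so no tuple has a block
        whose size fails to divide \<open>k\<close>.\<close>
      have "?B Y = {}"
      proof (rule ccontr)
        assume "?B Y \<noteq> {}"
        then obtain qs where qs: "qs \<in> transitive_perms (Suc l) ?X 0" "tuple_orbit (tl qs) 0 = Y" by blast
        have "length qs = Suc l" using commuting_permsD(1)[OF transitive_permsD(1)[OF qs(1)]] .
        then obtain q ps where qps: "qs = q # ps" by (cases qs) auto
        obtain m where "bij_betw (\<lambda>(i, y). (q ^^ i) y) ({..<m} \<times> Y) ?X"
          using cyclic_block_decomposition[OF finite_lessThan k qs(1)[unfolded qps] qs(2)[unfolded qps list.sel]] .
        from bij_betw_same_card[OF this] have "k = m * card Y" by (simp add: card_cartesian_product)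
        with False show False by simp
      qed
      then show ?thesis using False by (simp only: if_False card.empty)
    qed
  qed
  also have "\<dots> = (\<Sum>d=1..k. ((k - 1) choose (d - 1)) * ?f d)"
    using sum_pointed_subsets[of ?X 0 ?f] k by simp
  finally show ?thesis .
qed

text \<open>The number of subgroups of index \<open>k\<close> in \<open>\<int>\<^sup>l\<close>.\<close>

fun subgroup_count :: "nat \<Rightarrow> nat \<Rightarrow> nat" where
  "subgroup_count 0 k = (if k = 1 then 1 else 0)"
| "subgroup_count (Suc l) k = (\<Sum>d | d dvd k. d * subgroup_count l d)"

text \<open>A transitive tuple with base point 0 amounts to a stabilizer of index \<open>k\<close>
  with a labelling of its cosets in which the trivial coset is 0, giving \<open>(k - 1)!\<close>
  labellings. In the induction this factor comes out because choosing the block, filling it and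
  arranging the rest contribute a binomial coefficient, \<open>(d - 1)!\<close> and
  \<open>(k - d)!\<close>, whose product is \<open>(k - 1)!\<close>.\<close>

lemma num_transitive_eq:
  "1 \<le> k \<Longrightarrow> num_transitive l k = fact (k - 1) * subgroup_count l k"
proof (induction l arbitrary: k)
  case 0
  have "transitive_perms 0 {..<k} 0 = (if k = 1 then {[]} else {})"
  proof -
    have "tuple_orbit [] (0::nat) \<subseteq> {0}" by (rule tuple_orbit_subset) simp_all
    then have "tuple_orbit [] (0::nat) = {0}" using tuple_orbit.base[of "0::nat" "[]"] by blast
    moreover have "{0} = {..<k} \<longleftrightarrow> k = 1"
    proof
      assume "{0} = {..<k}"
      then have "card {0::nat} = card {..<k}" by simp
      then show "k = 1" by simp
    qed auto
    moreover have "commuting_perms 0 {..<k} = {[]}" by (auto simp: commuting_perms_def)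
    ultimately show ?thesis by (auto simp: transitive_perms_def)
  qed
  then show ?case by (simp add: num_transitive_def)
next
  case (Suc l)
  have "num_transitive (Suc l) k =
      (\<Sum>d\<in>{1..k}. if d dvd k then fact (k - 1) * (d * subgroup_count l d) else 0)"
    unfolding num_transitive_Suc[OF Suc.prems]
  proof (rule sum.cong[OF refl])
    fix d assume d: "d \<in> {1..k}"
    have F: "((k - 1) choose (d - 1)) * fact (d - 1) * fact (k - d) = (fact (k - 1) :: nat)"
      using binomial_fact_lemma[of "d - 1" "k - 1"] diff_le_mono[of d k 1] d by (simp add: ac_simps)
    have "((k - 1) choose (d - 1)) * (num_transitive l d * (d * fact (k - d))) =
        fact (k - 1) * (d * subgroup_count l d)"
      using Suc.IH[of d] d unfolding F[symmetric] by (simp add: ac_simps)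
    then show "((k - 1) choose (d - 1)) * (if d dvd k then num_transitive l d * (d * fact (k - d)) else 0) =
        (if d dvd k then fact (k - 1) * (d * subgroup_count l d) else 0)" by simp
  qed
  also have "\<dots> = (\<Sum>d | d dvd k. fact (k - 1) * (d * subgroup_count l d))"
    using Suc.prems by (intro sum.mono_neutral_cong_right) (auto dest: dvd_imp_le intro: Nat.gr0I)
  finally show ?case by (simp add: sum_distrib_left)
qed

lemma N_0: "N l 0 = 1"
proof -
  have "comm_tuples l 0 = {replicate l id}"
    unfolding comm_tuples_eq commuting_perms_def
    by (auto simp: replicate_eqI)
  then show ?thesis unfolding N_def sym_grp_def by simp
qed

text \<open>Division by \<open>n!\<close> absorbs the binomial coefficient and the factor
  \<open>(k - 1)!\<close>. In terms of generating functions this is the logarithmic derivative of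
  \<open>\<Sum> N_l(n) x^n = exp (\<Sum> J_l(k) x^k / k)\<close>.\<close>

lemma N_rec:
  assumes "1 \<le> n"
  shows "of_nat n * N l n = (\<Sum>k=1..n. of_nat (subgroup_count l k) * N l (n - k))"
proof -
  have N: "N l j = of_nat (num_commuting l j) / fact j" for j
    unfolding N_def comm_tuples_eq num_commuting_def sym_grp_def
    by (simp add: card_permutations[OF refl])
  have "of_nat n * N l n = of_nat (num_commuting l n) / fact (n - 1)"
    using assms by (simp add: N fact_reduce)
  also have "\<dots> = (\<Sum>k=1..n. of_nat (((n - 1) choose (k - 1)) *
      (num_transitive l k * num_commuting l (n - k))) / fact (n - 1))"
    using num_commuting_rec[OF assms, of l] by (simp add: sum_divide_distrib)
  also have "\<dots> = (\<Sum>k=1..n. of_nat (subgroup_count l k) * N l (n - k))"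
  proof (rule sum.cong[OF refl])
    fix k assume k: "k \<in> {1..n}"
    have "of_nat ((n - 1) choose (k - 1)) = (fact (n - 1) / (fact (k - 1) * fact (n - k)) :: rat)"
      using binomial_fact[of "k - 1" "n - 1", where 'a = rat] diff_le_mono[of k n 1] k by simp
    then show "of_nat (((n - 1) choose (k - 1)) * (num_transitive l k * num_commuting l (n - k))) / fact (n - 1) =
        of_nat (subgroup_count l k) * N l (n - k)"
      using num_transitive_eq[of k l] k by (simp add: N)
  qed
  finally show ?thesis .
qed

section \<open>Ranks below 80\<close>

text \<open>The indices go up to 21 because \<open>Delta l 20\<close> involves
  \<open>N l 21\<close>. Lists are 0-based, so index \<open>k\<close> sits at position
  \<open>k - 1\<close>.\<close>

definition divisor_table :: "nat list list" where
  "divisor_table = map (\<lambda>k. filter (\<lambda>d. d dvd k) [1..<Suc k]) [1..<22]"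

definition next_subgroup_row :: "nat list list \<Rightarrow> int list \<Rightarrow> int list" where
  "next_subgroup_row tab js = map (\<lambda>ds. sum_list (map (\<lambda>d. int d * js ! (d - 1)) ds)) tab"

primrec subgroup_row :: "nat list list \<Rightarrow> nat \<Rightarrow> int list" where
  "subgroup_row tab 0 = 1 # replicate 20 0"
| "subgroup_row tab (Suc l) = next_subgroup_row tab (subgroup_row tab l)"

text \<open>Fixed point numbers with 24 binary digits. To keep them small, \<open>N l n\<close> is divided by
  \<open>2 ^ (n * s)\<close>, which does not change the sign of \<open>Delta l n\<close>. The parameter \<open>\<delta>\<close> is 0 for lower and 1
  for upper bounds.\<close>

primrec scaled_row :: "int \<Rightarrow> nat \<Rightarrow> nat \<Rightarrow> int list \<Rightarrow> int list" where
  "scaled_row \<delta> s e [] = []"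
| "scaled_row \<delta> s e (j # js) = (drop_bit e (16777216 * j) + \<delta>) # scaled_row \<delta> s (e + s) js"

fun dot_product :: "int list \<Rightarrow> int list \<Rightarrow> int" where
  "dot_product (a # as) (b # bs) = a * b + dot_product as bs"
| "dot_product _ _ = 0"

text \<open>Values are stored newest first, which turns the convolution in \<open>N_rec\<close> into
  a plain dot product. Dropping 24 bits removes the second scale factor from a product of two fixed
  point numbers.\<close>

primrec scaled_values :: "int \<Rightarrow> int list \<Rightarrow> nat \<Rightarrow> int \<Rightarrow> int list \<Rightarrow> int list" where
  "scaled_values \<delta> as 0 n ys = ys"
| "scaled_values \<delta> as (Suc m) n ys =
    scaled_values \<delta> as m (n + 1) ((drop_bit 24 (dot_product as ys) div n + \<delta>) # ys)"

text \<open>With the newest value first, \<open>a\<close>, \<open>b\<close>, \<open>c\<close> bound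
  \<open>N l (n + 1)\<close>, \<open>N l n\<close>, \<open>N l (n - 1)\<close> from below and the
  primed ones from above. The inequality is strict only for exceptions, since
  \<open>Delta l n = 0\<close> is none.\<close>

fun signs_ok :: "int list \<Rightarrow> int list \<Rightarrow> bool list \<Rightarrow> bool" where
  "signs_ok (a # b # c # los) (a' # b' # c' # his) (e # es) \<longleftrightarrow>
     (if e then b' * b' < a * c else a' * c' \<le> b * b) \<and> signs_ok (b # c # los) (b' # c' # his) es"
| "signs_ok _ _ es \<longleftrightarrow> es = []"

text \<open>Listed from \<open>n = 20\<close> down to \<open>n = 2\<close>, with unbounded intervals cut off at 80.\<close>

definition exc_table :: "(nat \<times> nat) list list" where
  "exc_table = [[(27, 80)], [(2, 4), (32, 80)], [], [(2, 6), (24, 54)], [(29, 80)], [(2, 8)],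
     [(20, 44)], [(2, 9), (26, 80)], [], [(2, 35)], [(22, 80)], [(2, 12)], [(15, 26)], [(2, 80)],
     [], [(2, 19)], [(16, 80)], [(2, 13)], []]"

text \<open>The scaling exponent \<open>l div 2\<close> fits because \<open>N l n\<close> grows
  roughly like \<open>3^(n l / 3)\<close> and the cube root of 3 is close to the square root of 2.
  The start value 16777216 is \<open>2^24\<close>, which represents \<open>N l 0 = 1\<close>
  exactly.\<close>

definition certified :: "nat \<Rightarrow> int list \<Rightarrow> bool" where
  "certified l js \<longleftrightarrow> signs_ok
     (scaled_values 0 (scaled_row 0 (l div 2) (l div 2) js) 21 1 [16777216])
     (scaled_values 1 (scaled_row 1 (l div 2) (l div 2) js) 21 1 [16777216])
     (map (list_ex (\<lambda>(a, b). a \<le> l \<and> l \<le> b)) exc_table)"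

primrec certified_from :: "nat list list \<Rightarrow> nat \<Rightarrow> nat \<Rightarrow> int list \<Rightarrow> bool" where
  "certified_from tab 0 l js \<longleftrightarrow> True"
| "certified_from tab (Suc m) l js \<longleftrightarrow> certified l js \<and> certified_from tab m (Suc l) (next_subgroup_row tab js)"


section \<open>Correctness of the interval evaluation\<close>

lemma subgroup_row_eq: "length (subgroup_row divisor_table l) = 21 \<and>
    (\<forall>k\<in>{1..21}. subgroup_row divisor_table l ! (k - 1) = int (subgroup_count l k))"
proof (induction l)
  case 0
  show ?case by (auto simp: nth_Cons split: nat.splits)
next
  case (Suc l)
  have "subgroup_row divisor_table (Suc l) ! (k - 1) = int (subgroup_count (Suc l) k)" if k: "k \<in> {1..21}" for k
  proof -
    obtain j where j: "k = Suc j" "j < 21" using k by (cases k) auto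
    have nth: "[1..<22] ! j = k" using j by (subst nth_upt) auto
    have set: "set (filter (\<lambda>d. d dvd k) [1..<Suc k]) = {d. d dvd k}"
      using k by (auto dest: dvd_imp_le intro: Nat.gr0I)
    have "subgroup_row divisor_table (Suc l) ! (k - 1) =
        (\<Sum>d\<leftarrow>filter (\<lambda>d. d dvd k) [1..<Suc k]. int d * subgroup_row divisor_table l ! (d - 1))"
    proof -
      have "divisor_table ! (k - 1) = filter (\<lambda>d. d dvd k) [1..<Suc k]" "k - 1 < length divisor_table"
        using j nth by (simp_all add: divisor_table_def del: upt_Suc upt_rec_numeral)
      then show ?thesis by (simp add: next_subgroup_row_def)
    qed
    also have "\<dots> = (\<Sum>d | d dvd k. int d * subgroup_row divisor_table l ! (d - 1))"
      by (subst sum_list_distinct_conv_sum_set) (simp_all only: set distinct_filter distinct_upt)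
    also have "\<dots> = (\<Sum>d | d dvd k. int (d * subgroup_count l d))"
    proof (rule sum.cong[OF refl])
      fix d assume "d \<in> {d. d dvd k}"
      then have "d \<in> {1..21}" using k by (auto dest: dvd_imp_le intro: Nat.gr0I)
      then show "int d * subgroup_row divisor_table l ! (d - 1) = int (d * subgroup_count l d)"
        using Suc by simp
    qed
    finally show ?thesis by simp
  qed
  then show ?case by (auto simp: next_subgroup_row_def divisor_table_def)
qed

lemma certified_fromD:
  assumes "certified_from divisor_table m l (subgroup_row divisor_table l)" "l \<le> l'" "l' < l + m"
  shows "certified l' (subgroup_row divisor_table l')"
  using assms
proof (induction m arbitrary: l)
  case (Suc m)
  then show ?case using Suc.IH[of "Suc l"] by (cases "l = l'") auto
qed simp

lemma of_int_div_le:
  fixes a b :: int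
  assumes "0 < b"
  shows "(of_int (a div b) :: rat) \<le> of_int a / of_int b" "(of_int a / of_int b :: rat) \<le> of_int (a div b + 1)"
proof -
  have fl: "\<lfloor>of_int a / of_int b :: rat\<rfloor> = a div b" by (rule floor_divide_of_int_eq)
  show "(of_int (a div b) :: rat) \<le> of_int a / of_int b" unfolding fl[symmetric] by (rule of_int_floor_le)
  show "(of_int a / of_int b :: rat) \<le> of_int (a div b + 1)"
    using floor_correct[of "of_int a / of_int b :: rat"] unfolding fl by simp
qed

lemma length_scaled_row [simp]: "length (scaled_row \<delta> s e js) = length js"
  by (induction js arbitrary: e) auto

lemma nth_scaled_row:
  "i < length js \<Longrightarrow> scaled_row \<delta> s e js ! i = (16777216 * js ! i) div 2 ^ (e + i * s) + \<delta>"
proof (induction js arbitrary: e i)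
  case (Cons j js)
  then show ?case by (cases i) (auto simp: drop_bit_eq_div algebra_simps)
qed simp

lemma scaled_row_bounds:
  assumes "i < length js"
  shows "of_int (scaled_row 0 s e js ! i) \<le> (16777216 * of_int (js ! i) / 2 ^ (e + i * s) :: rat)"
    "(16777216 * of_int (js ! i) / 2 ^ (e + i * s) :: rat) \<le> of_int (scaled_row 1 s e js ! i)"
  using of_int_div_le[of "2 ^ (e + i * s)" "16777216 * js ! i"] nth_scaled_row[OF assms] by simp_all

lemma dot_product_eq: "length bs \<le> length as \<Longrightarrow> dot_product as bs = (\<Sum>i<length bs. as ! i * bs ! i)"
proof (induction as bs rule: dot_product.induct)
  case (1 a as b bs)
  then show ?case by (simp add: sum.lessThan_Suc_shift del: sum.lessThan_Suc)
qed auto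

lemma length_scaled_values [simp]: "length (scaled_values \<delta> as m n ys) = m + length ys"
  by (induction m arbitrary: n ys) auto

text \<open>The invariant concerns reversed lists: position \<open>i\<close> encloses
  \<open>Z (n - 1 - i)\<close>. Since lower bounds stay nonnegative, products of bounds are again
  bounds, and the rounding of each new value is absorbed by adding 0 below or 1 above.\<close>

lemma scaled_values_bounds:
  fixes A Z :: "nat \<Rightarrow> rat"
  assumes nonneg: "\<And>k. 0 \<le> A k" "\<And>n. 0 \<le> Z n"
    and rec: "\<And>n. 1 \<le> n \<Longrightarrow> of_nat n * Z n = (\<Sum>k=1..n. A k * Z (n - k)) / 16777216"
    and len: "length as = K" "length as' = K"
    and as: "\<And>i. i < K \<Longrightarrow> 0 \<le> as ! i \<and> of_int (as ! i) \<le> A (Suc i) \<and> A (Suc i) \<le> of_int (as' ! i)"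
    and ys: "length ys = n" "length ys' = n"
      "\<And>i. i < n \<Longrightarrow> 0 \<le> ys ! i \<and> of_int (ys ! i) \<le> Z (n - 1 - i) \<and> Z (n - 1 - i) \<le> of_int (ys' ! i)"
    and n: "1 \<le> n" "n + m \<le> Suc K"
    and i: "i < n + m"
  shows "0 \<le> scaled_values 0 as m (int n) ys ! i \<and>
    of_int (scaled_values 0 as m (int n) ys ! i) \<le> Z (n + m - 1 - i) \<and>
    Z (n + m - 1 - i) \<le> of_int (scaled_values 1 as' m (int n) ys' ! i)"
  using ys n i
proof (induction m arbitrary: n ys ys')
  case (Suc m)
  let ?y = "drop_bit 24 (dot_product as ys) div int n" and ?y' = "drop_bit 24 (dot_product as' ys') div int n + 1"
  have nK: "n \<le> K" using Suc.prems by simp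
  have Zn: "of_nat n * (16777216 * Z n) = (\<Sum>i<n. A (Suc i) * Z (n - 1 - i))"
  proof -
    have "(\<Sum>k=1..n. A k * Z (n - k)) = (\<Sum>i<n. A (Suc i) * Z (n - Suc i))"
      by (rule sum.reindex_bij_witness[of _ Suc "\<lambda>k. k - 1"]) auto
    then show ?thesis using rec[OF Suc.prems(4)] by simp
  qed
  have dot_product: "dot_product as ys = (\<Sum>i<n. as ! i * ys ! i)" "dot_product as' ys' = (\<Sum>i<n. as' ! i * ys' ! i)"
    using dot_product_eq[of ys as] dot_product_eq[of ys' as'] Suc.prems(1,2) len nK by simp_all
  \<comment> \<open>Two successive floor divisions equal one, so only a single rounding has to be
    covered.\<close>
  have div: "drop_bit 24 x div int n = x div (16777216 * int n)" for x :: int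
    by (simp add: drop_bit_eq_div zdiv_zmult2_eq)
  have pos: "0 < 16777216 * int n" using Suc.prems(4) by simp
  have 1: "0 \<le> ?y"
    unfolding div dot_product using pos as Suc.prems(3) nK
    by (intro pos_imp_zdiv_nonneg_iff[THEN iffD2] sum_nonneg mult_nonneg_nonneg) auto
  have "(of_int (dot_product as ys) :: rat) \<le> (\<Sum>i<n. A (Suc i) * Z (n - 1 - i))"
    unfolding dot_product of_int_sum of_int_mult
    using as Suc.prems(3) nK nonneg by (intro sum_mono mult_mono) auto
  then have "of_int (dot_product as ys) / of_int (16777216 * int n) \<le> Z n"
    using pos unfolding Zn[symmetric] by (simp add: field_simps)
  then have 2: "of_int ?y \<le> Z n"
    unfolding div using of_int_div_le(1)[OF pos, of "dot_product as ys"] by linarith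
  have "(\<Sum>i<n. A (Suc i) * Z (n - 1 - i)) \<le> (of_int (dot_product as' ys') :: rat)"
    unfolding dot_product of_int_sum of_int_mult
  proof (intro sum_mono mult_mono)
    fix i assume "i \<in> {..<n}"
    then show "A (Suc i) \<le> of_int (as' ! i)" "Z (n - 1 - i) \<le> of_int (ys' ! i)"
      using as[of i] Suc.prems(3)[of i] nK by auto
    then show "0 \<le> (of_int (as' ! i) :: rat)" using nonneg(1) order_trans by blast
  qed (rule nonneg)
  then have "Z n \<le> of_int (dot_product as' ys') / of_int (16777216 * int n)"
    using pos unfolding Zn[symmetric] by (simp add: field_simps)
  then have 3: "Z n \<le> of_int ?y'"
    unfolding div using of_int_div_le(2)[OF pos, of "dot_product as' ys'"] by linarith
  have "0 \<le> scaled_values 0 as m (int (Suc n)) (?y # ys) ! i \<and>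
      of_int (scaled_values 0 as m (int (Suc n)) (?y # ys) ! i) \<le> Z (Suc n + m - 1 - i) \<and>
      Z (Suc n + m - 1 - i) \<le> of_int (scaled_values 1 as' m (int (Suc n)) (?y' # ys') ! i)"
  proof (rule Suc.IH)
    fix i assume i: "i < Suc n"
    show "0 \<le> (?y # ys) ! i \<and> of_int ((?y # ys) ! i) \<le> Z (Suc n - 1 - i) \<and>
        Z (Suc n - 1 - i) \<le> of_int ((?y' # ys') ! i)"
    proof (cases i)
      case 0
      then show ?thesis using 1 2 3 by simp
    next
      case (Suc j)
      then show ?thesis using Suc.prems(3)[of j] i by simp
    qed
  qed (use Suc.prems in auto)
  then show ?case by (simp add: algebra_simps)
qed simp

lemma signs_okD:
  "signs_ok los his es \<Longrightarrow> i < length es \<Longrightarrow> i + 2 < length los \<Longrightarrow> i + 2 < length his \<Longrightarrow>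
    (if es ! i then his ! (i + 1) * his ! (i + 1) < los ! i * los ! (i + 2)
     else his ! i * his ! (i + 2) \<le> los ! (i + 1) * los ! (i + 1))"
proof (induction los his es arbitrary: i rule: signs_ok.induct)
  case (1 a b c los a' b' c' his e es)
  show ?case
  proof (cases i)
    case 0
    then show ?thesis using "1.prems"(1) by (cases e) auto
  next
    case (Suc j)
    then show ?thesis using "1.IH"[of j] "1.prems" by (cases "es ! j") (simp_all add: numeral_2_eq_2)
  qed
qed auto

lemma N_nonneg: "0 \<le> N l n"
  by (simp add: N_def)

lemma certified_Delta:
  assumes "certified l (subgroup_row divisor_table l)" "2 \<le> n" "n \<le> 20"
  shows "Delta l n < 0 \<longleftrightarrow> list_ex (\<lambda>(a, b). a \<le> l \<and> l \<le> b) (exc_table ! (20 - n))"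
proof -
  define s where "s = l div 2"
  let ?js = "subgroup_row divisor_table l"
  define A :: "nat \<Rightarrow> rat" where "A k = 16777216 * of_nat (subgroup_count l k) / 2 ^ (k * s)" for k
  define Z :: "nat \<Rightarrow> rat" where "Z k = 16777216 * N l k / 2 ^ (k * s)" for k
  define los where "los = scaled_values 0 (scaled_row 0 s s ?js) 21 1 [16777216]"
  define his where "his = scaled_values 1 (scaled_row 1 s s ?js) 21 1 [16777216]"
  have rec: "of_nat j * Z j = (\<Sum>k=1..j. A k * Z (j - k)) / 16777216" if "1 \<le> j" for j
  proof -
    have "of_nat j * Z j = 16777216 / 2 ^ (j * s) * (of_nat j * N l j)" by (simp add: Z_def)
    also have "\<dots> = (\<Sum>k=1..j. 16777216 / 2 ^ (j * s) * (of_nat (subgroup_count l k) * N l (j - k)))"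
      unfolding N_rec[OF that] by (simp add: sum_distrib_left)
    also have "\<dots> = (\<Sum>k=1..j. A k * Z (j - k) / 16777216)"
    proof (rule sum.cong[OF refl])
      fix k assume "k \<in> {1..j}"
      then have "j * s = k * s + (j - k) * s" by (simp flip: add_mult_distrib)
      then have "(2::rat) ^ (j * s) = 2 ^ (k * s) * 2 ^ ((j - k) * s)" by (simp add: power_add)
      then show "16777216 / 2 ^ (j * s) * (of_nat (subgroup_count l k) * N l (j - k)) =
          A k * Z (j - k) / 16777216" by (simp add: A_def Z_def)
    qed
    finally show ?thesis by (simp add: sum_divide_distrib)
  qed
  have bounds: "0 \<le> los ! i \<and> of_int (los ! i) \<le> Z (21 - i) \<and> Z (21 - i) \<le> of_int (his ! i)" if "i < 22" for i
  proof -
    have as: "0 \<le> scaled_row 0 s s ?js ! i \<and> of_int (scaled_row 0 s s ?js ! i) \<le> A (Suc i) \<and>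
        A (Suc i) \<le> of_int (scaled_row 1 s s ?js ! i)" if "i < 21" for i
    proof -
      have i: "i < length ?js" "?js ! i = int (subgroup_count l (Suc i))"
        using subgroup_row_eq[of l] that by (auto dest!: bspec[of _ _ "Suc i"])
      then have "0 \<le> scaled_row 0 s s ?js ! i"
        by (simp add: nth_scaled_row[OF i(1)] pos_imp_zdiv_nonneg_iff)
      then show ?thesis using scaled_row_bounds[OF i(1), of s s] i(2) by (simp add: A_def)
    qed
    have "0 \<le> scaled_values 0 (scaled_row 0 s s ?js) 21 (int 1) [16777216] ! i \<and>
        of_int (scaled_values 0 (scaled_row 0 s s ?js) 21 (int 1) [16777216] ! i) \<le> Z (1 + 21 - 1 - i) \<and>
        Z (1 + 21 - 1 - i) \<le> of_int (scaled_values 1 (scaled_row 1 s s ?js) 21 (int 1) [16777216] ! i)"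
      by (rule scaled_values_bounds[where A = A and K = 21])
        (use as rec subgroup_row_eq[of l] that in \<open>auto simp: A_def Z_def N_nonneg N_0\<close>)
    then show ?thesis by (simp add: los_def his_def)
  qed
  \<comment> \<open>The lists run from index 21 down to 0, so positions \<open>i\<close>,
    \<open>i + 1\<close>, \<open>i + 2\<close> belong to \<open>n + 1\<close>, \<open>n\<close>,
    \<open>n - 1\<close>.\<close>
  define i where "i = 20 - n"
  have i: "i < 19" "21 - (i + 1) = n" "21 - i = n + 1" "21 - (i + 2) = n - 1"
    using assms(2,3) by (auto simp: i_def)
  let ?es = "map (list_ex (\<lambda>(a, b). a \<le> l \<and> l \<le> b)) exc_table"
  have len: "length exc_table = 19" by (simp add: exc_table_def)
  have "signs_ok los his ?es"
    using assms(1) by (simp add: certified_def los_def his_def s_def)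
  then have w: "if ?es ! i then his ! (i + 1) * his ! (i + 1) < los ! i * los ! (i + 2)
      else his ! i * his ! (i + 2) \<le> los ! (i + 1) * los ! (i + 1)"
    by (rule signs_okD) (use i len subgroup_row_eq[of l] in \<open>auto simp: los_def his_def\<close>)
  have b: "0 \<le> los ! i" "of_int (los ! i) \<le> Z (n + 1)" "Z (n + 1) \<le> of_int (his ! i)"
    "0 \<le> los ! (i + 1)" "of_int (los ! (i + 1)) \<le> Z n" "Z n \<le> of_int (his ! (i + 1))"
    "0 \<le> los ! (i + 2)" "of_int (los ! (i + 2)) \<le> Z (n - 1)" "Z (n - 1) \<le> of_int (his ! (i + 2))"
    using bounds[of i] bounds[of "i + 1"] bounds[of "i + 2"] i by auto
  have Z0: "0 \<le> Z j" for j by (simp add: Z_def N_nonneg)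
  have "(2::rat) ^ ((n - 1) * s) * 2 ^ ((n + 1) * s) = (2 ^ (n * s)) ^ 2"
  proof -
    have "(n - 1) * s + (n + 1) * s = n * s * 2" using assms(2) by (cases n) (auto simp: algebra_simps)
    then show ?thesis by (simp only: flip: power_add power_mult)
  qed
  then have D: "Z n * Z n - Z (n - 1) * Z (n + 1) = 16777216 ^ 2 / (2 ^ (n * s)) ^ 2 * Delta l n"
    by (simp add: Z_def Delta_def power2_eq_square field_simps)
  have iff: "Delta l n < 0 \<longleftrightarrow> Z n * Z n < Z (n - 1) * Z (n + 1)"
  proof -
    have "0 < (16777216 ^ 2 / (2 ^ (n * s)) ^ 2 :: rat)" by simp
    then have "Delta l n < 0 \<longleftrightarrow> 16777216 ^ 2 / (2 ^ (n * s)) ^ 2 * Delta l n < 0"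
      by (simp only: mult_less_0_iff) auto
    then show ?thesis unfolding D[symmetric] by simp
  qed
  have "Delta l n < 0 \<longleftrightarrow> ?es ! i"
  proof (cases "?es ! i")
    case True
    have "Z n * Z n \<le> of_int (his ! (i + 1)) * of_int (his ! (i + 1))"
      using b Z0[of n] by (intro mult_mono) linarith+
    also have "\<dots> < of_int (los ! i) * of_int (los ! (i + 2))"
      using w True by (simp only: if_True of_int_less_iff flip: of_int_mult)
    also have "\<dots> \<le> Z (n + 1) * Z (n - 1)"
      using b Z0 by (intro mult_mono) auto
    finally show ?thesis using True iff by (simp add: mult.commute)
  next
    case False
    have "Z (n + 1) * Z (n - 1) \<le> of_int (his ! i) * of_int (his ! (i + 2))"
      using b Z0[of "n - 1"] Z0[of "n + 1"] by (intro mult_mono) linarith+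
    also have "\<dots> \<le> of_int (los ! (i + 1)) * of_int (los ! (i + 1))"
      using w False by (simp only: if_False of_int_le_iff flip: of_int_mult)
    also have "\<dots> \<le> Z n * Z n"
      using b Z0 by (intro mult_mono) auto
    finally show ?thesis using False iff by (simp add: mult.commute)
  qed
  then show ?thesis using i(1) len by (simp add: i_def)
qed

text \<open>The evaluation starts at rank 2: at rank 1 every \<open>N\<close> is 1 and
  \<open>Delta\<close> vanishes, a tie that rounded enclosures cannot settle.\<close>

lemma certified_2_20: "certified_from divisor_table 19 2 (subgroup_row divisor_table 2)"
  by code_simp

lemma certified_21_40: "certified_from divisor_table 20 21 (subgroup_row divisor_table 21)"
  by code_simp

lemma certified_41_60: "certified_from divisor_table 20 41 (subgroup_row divisor_table 41)"
  by code_simp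

lemma certified_61_79: "certified_from divisor_table 19 61 (subgroup_row divisor_table 61)"
  by code_simp

lemma Delta_small_l:
  assumes "2 \<le> l" "l < 80" "2 \<le> n" "n \<le> 20"
  shows "Delta l n < 0 \<longleftrightarrow> l \<in> exc_set n"
proof -
  have "certified l (subgroup_row divisor_table l)"
    using certified_fromD[OF certified_2_20, of l] certified_fromD[OF certified_21_40, of l]
      certified_fromD[OF certified_41_60, of l] certified_fromD[OF certified_61_79, of l] assms(1,2)
    by (cases "l \<le> 20"; cases "l \<le> 40"; cases "l \<le> 60") auto
  note * = certified_Delta[OF this assms(3,4)]
  have "n \<in> {2,3,4,5,6,7,8,9,10,11,12,13,14,15,16,17,18,19,20}"
    using assms(3,4) by (simp only: insert_iff empty_iff) presburger
  then show ?thesis unfolding * using assms(1,2)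
    by (elim insertE) (simp_all add: exc_table_def exc_set_def)
qed

section \<open>Ranks from 80 on\<close>

lemma divisors_2_3_4:
  "{d::nat. d dvd 2} = {1, 2}" "{d::nat. d dvd 3} = {1, 3}" "{d::nat. d dvd 4} = {1, 2, 4}"
proof -
  have *: "d dvd m \<Longrightarrow> m \<le> 4 \<Longrightarrow> 0 < m \<Longrightarrow> d = 0 \<or> d = 1 \<or> d = 2 \<or> d = 3 \<or> d = 4" for d m :: nat
    using dvd_imp_le[of d m] by linarith
  have "d dvd 2 \<longleftrightarrow> d = 1 \<or> d = 2" for d :: nat using *[of d 2] by auto
  moreover have "d dvd 3 \<longleftrightarrow> d = 1 \<or> d = 3" for d :: nat using *[of d 3] by auto
  moreover have "d dvd 4 \<longleftrightarrow> d = 1 \<or> d = 2 \<or> d = 4" for d :: nat using *[of d 4] by auto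
  ultimately show "{d::nat. d dvd 2} = {1, 2}" "{d::nat. d dvd 3} = {1, 3}" "{d::nat. d dvd 4} = {1, 2, 4}"
    by auto
qed

lemma subgroup_count_1: "subgroup_count l 1 = 1"
  by (induction l) auto

lemma subgroup_count_2: "(of_nat (subgroup_count l 2) :: rat) = 2 ^ l - 1"
proof (induction l)
  case (Suc l)
  then show ?case using divisors_2_3_4 subgroup_count_1[of l] by simp
qed simp

lemma subgroup_count_3: "(of_nat (subgroup_count l 3) :: rat) = (3 ^ l - 1) / 2"
proof (induction l)
  case (Suc l)
  then show ?case using divisors_2_3_4 subgroup_count_1[of l] by simp
qed simp

lemma subgroup_count_4: "(of_nat (subgroup_count l 4) :: rat) = (2 * 4 ^ l - 3 * 2 ^ l + 1) / 3"
proof (induction l)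
  case (Suc l)
  then show ?case using divisors_2_3_4 subgroup_count_1[of l] subgroup_count_2[of l] by (simp add: field_simps)
qed simp

lemma subgroup_count_rank_1:
  assumes "1 \<le> k"
  shows "subgroup_count 1 k = 1"
proof -
  have "{d. d dvd k} \<inter> {1} = {1}" by auto
  then show ?thesis using assms by (simp add: if_distrib[of "(*) _"] sum.If_cases cong: if_cong)
qed

text \<open>With the complementary divisor \<open>e = k / d\<close> the summand becomes
  \<open>k / (e (e - 1))\<close>; summed over all \<open>e\<close> from 2 to \<open>k\<close> this
  telescopes to \<open>k - 1\<close>. It is the base case of the induction that follows.\<close>

lemma sum_inverse_divisors_le:
  assumes "1 \<le> k"
  shows "(\<Sum>d | d dvd k \<and> d < k. of_nat d ^ 2 / (of_nat k - of_nat d) :: rat) \<le> of_nat k - 1"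
proof -
  have "(\<Sum>d | d dvd k \<and> d < k. of_nat d ^ 2 / (of_nat k - of_nat d) :: rat) =
      (\<Sum>e | e dvd k \<and> 2 \<le> e. of_nat k * (1 / (of_nat e - 1) - 1 / of_nat e))"
  proof (rule sum.reindex_bij_witness[of _ "\<lambda>e. k div e" "\<lambda>d. k div d"])
    fix d assume "d \<in> {d. d dvd k \<and> d < k}"
    then obtain e where e: "k = d * e" "d < k" by (auto elim: dvdE)
    have "0 < d" using e assms by (cases d) auto
    have "e \<noteq> 0" "e \<noteq> 1" using e assms by auto
    then have e2: "2 \<le> e" by simp
    then show "k div (k div d) = d" "k div d \<in> {e. e dvd k \<and> 2 \<le> e}" using e \<open>0 < d\<close> by auto
    have "of_nat k - of_nat d = (of_nat d * (of_nat e - 1) :: rat)" using e by (simp add: algebra_simps)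
    then show "of_nat k * (1 / (of_nat (k div d) - 1) - 1 / of_nat (k div d)) =
        (of_nat d ^ 2 / (of_nat k - of_nat d) :: rat)"
      using e e2 \<open>0 < d\<close> by (simp add: field_simps power2_eq_square)
  next
    fix e assume "e \<in> {e. e dvd k \<and> 2 \<le> e}"
    then obtain d where d: "k = e * d" "2 \<le> e" by (auto elim: dvdE)
    have "0 < d" using d assms by (cases d) auto
    then show "k div (k div e) = e" "k div e \<in> {d. d dvd k \<and> d < k}" using d by auto
  qed
  also have "\<dots> \<le> (\<Sum>e\<in>{2..k}. of_nat k * (1 / (of_nat e - 1) - 1 / of_nat e))"
    using assms by (intro sum_mono2) (auto dest: dvd_imp_le simp: field_simps)
  also have "\<dots> = of_nat k - 1"
  proof -
    have "(\<Sum>e\<in>{2..Suc m}. 1 / (of_nat e - 1) - 1 / of_nat e :: rat) = 1 - 1 / of_nat (Suc m)" for m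
      by (induction m) (simp_all add: numeral_2_eq_2)
    from this[of "k - 1"] have "(\<Sum>e\<in>{2..k}. 1 / (of_nat e - 1) - 1 / of_nat e :: rat) = 1 - 1 / of_nat k"
      using assms by simp
    then show ?thesis using assms unfolding sum_distrib_left[symmetric] by (simp add: right_diff_distrib)
  qed
  finally show ?thesis .
qed

text \<open>The correction term is what makes the induction on \<open>l\<close> close up.\<close>

lemma subgroup_count_le_aux:
  "1 \<le> k \<Longrightarrow> of_nat (subgroup_count (Suc l) k) +
    (\<Sum>d | d dvd k \<and> d < k. of_nat d ^ (l + 2) / (of_nat k - of_nat d)) \<le> (of_nat k ^ Suc l :: rat)"
proof (induction l arbitrary: k)
  case 0
  show ?case using subgroup_count_rank_1[OF 0] sum_inverse_divisors_le[OF 0]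
    by (simp add: numeral_2_eq_2)
next
  case (Suc l)
  let ?D = "{d. d dvd k \<and> d < k}"
  have D: "{d. d dvd k} = insert k ?D" using Suc.prems by (auto dest: dvd_imp_le)
  have "(of_nat (subgroup_count (Suc (Suc l)) k) :: rat) =
      of_nat k * of_nat (subgroup_count (Suc l) k) + (\<Sum>d\<in>?D. of_nat d * of_nat (subgroup_count (Suc l) d))"
    unfolding subgroup_count.simps(2)[of "Suc l"] D using Suc.prems
    by (subst sum.insert) (auto simp del: subgroup_count.simps)
  also have "\<dots> \<le> of_nat k * (of_nat k ^ Suc l - (\<Sum>d\<in>?D. of_nat d ^ (l + 2) / (of_nat k - of_nat d)))
      + (\<Sum>d\<in>?D. of_nat d ^ (l + 2))"
  proof (rule add_mono[OF mult_left_mono sum_mono])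
    show "of_nat (subgroup_count (Suc l) k) \<le>
        (of_nat k ^ Suc l - (\<Sum>d\<in>?D. of_nat d ^ (l + 2) / (of_nat k - of_nat d)) :: rat)"
      using Suc.IH[OF Suc.prems] by linarith
    fix d assume "d \<in> ?D"
    then have d: "1 \<le> d" using Suc.prems by (auto intro: Nat.gr0I simp: Suc_le_eq)
    have "0 \<le> (\<Sum>c | c dvd d \<and> c < d. of_nat c ^ (l + 2) / (of_nat d - of_nat c) :: rat)"
      by (intro sum_nonneg divide_nonneg_nonneg) auto
    then have "of_nat (subgroup_count (Suc l) d) \<le> (of_nat d ^ Suc l :: rat)"
      using Suc.IH[OF d] by linarith
    then have "of_nat d * of_nat (subgroup_count (Suc l) d) \<le> (of_nat d * of_nat d ^ Suc l :: rat)"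
      by (intro mult_left_mono) auto
    then show "of_nat d * of_nat (subgroup_count (Suc l) d) \<le> (of_nat d ^ (l + 2) :: rat)" by simp
  qed simp
  also have "\<dots> = of_nat k ^ Suc (Suc l) -
      (\<Sum>d\<in>?D. of_nat k * (of_nat d ^ (l + 2) / (of_nat k - of_nat d)) - of_nat d ^ (l + 2))"
    by (simp add: sum_subtractf sum_distrib_left algebra_simps)
  \<comment> \<open>As \<open>k / (k - d) - 1 = d / (k - d)\<close>, the correction term reproduces
    itself with the exponent raised by one.\<close>
  also have "(\<Sum>d\<in>?D. of_nat k * (of_nat d ^ (l + 2) / (of_nat k - of_nat d)) - of_nat d ^ (l + 2)) =
      (\<Sum>d\<in>?D. of_nat d ^ (Suc l + 2) / (of_nat k - of_nat d) :: rat)"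
  proof (rule sum.cong[OF refl])
    fix d assume "d \<in> ?D"
    then have "(of_nat k - of_nat d :: rat) \<noteq> 0" by simp
    then show "of_nat k * (of_nat d ^ (l + 2) / (of_nat k - of_nat d)) - of_nat d ^ (l + 2) =
        (of_nat d ^ (Suc l + 2) / (of_nat k - of_nat d) :: rat)" by (simp add: field_simps)
  qed
  finally show ?case by simp
qed

text \<open>The absence of a constant factor matters: it keeps every coefficient of the scaled
  recurrence at most 1, so that \<open>scaled_N\<close> is bounded by 1.\<close>

lemma subgroup_count_le:
  assumes "1 \<le> l" "1 \<le> k"
  shows "(of_nat (subgroup_count l k) :: rat) \<le> of_nat k ^ l"
proof -
  obtain m where m: "l = Suc m" using assms(1) by (cases l) auto
  have "0 \<le> (\<Sum>d | d dvd k \<and> d < k. of_nat d ^ (m + 2) / (of_nat k - of_nat d) :: rat)"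
    by (intro sum_nonneg divide_nonneg_nonneg) auto
  then show ?thesis using subgroup_count_le_aux[OF assms(2), of m] unfolding m by linarith
qed

text \<open>For \<open>n \<noteq> 1\<close> this is the largest product of the parts of a partition of \<open>n\<close>, so \<open>N l n\<close> grows like
  \<open>growth n ^ l\<close>; the value at 1 makes \<open>growth (n + 3) = 3 * growth n\<close> hold throughout.\<close>

fun growth :: "nat \<Rightarrow> rat" where
  "growth 0 = 1"
| "growth (Suc 0) = 4 / 3"
| "growth (Suc (Suc 0)) = 2"
| "growth (Suc (Suc (Suc n))) = 3 * growth n"

lemma growth_pos: "0 < growth n"
  by (induction n rule: growth.induct) auto

text \<open>Powers of 3 cancel on both sides, so only the residues of \<open>j\<close> and
  \<open>k\<close> modulo 3 have to be compared.\<close>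

lemma growth_mult_le: "growth j * growth k \<le> growth (j + k)"
proof (induction k arbitrary: j rule: growth.induct)
  case 2
  show ?case by (induction j rule: growth.induct) auto
next
  case 3
  show ?case by (induction j rule: growth.induct) auto
next
  case (4 k)
  then show ?case using "4.IH"[of j] by simp
qed simp

lemma growth_numerals:
  "growth 2 = 2" "growth 3 = 3" "growth 4 = 4" "growth 5 = 6" "growth 6 = 9"
  "growth 7 = 12" "growth 8 = 18" "growth 9 = 27"
  by (simp_all add: numeral_eq_Suc)

lemma growth_add_3: "growth (n + 3) = 3 * growth n"
  by (simp add: numeral_3_eq_3)

lemma growth_add_mult_3: "growth (i + 3 * q) = 3 ^ q * growth i"
proof (induction q)
  case (Suc q)
  have "growth (i + 3 * Suc q) = growth (i + 3 * q + 3)" by (simp add: algebra_simps)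
  then show ?case using Suc by (simp add: growth_add_3)
qed simp

text \<open>The relative loss caused by a part of size 2, 3 or 4: none if an optimal product can
  contain this part, and otherwise \<open>8/9\<close>, from trading two 3s for three 2s (with
  \<open>growth 1\<close> fitted to the pattern).\<close>

lemma growth_ratio:
  "2 * growth m / growth (m + 2) = (if (m + 2) mod 3 = 0 then 8 / 9 else 1)"
  "3 * growth m / growth (m + 3) = 1"
  "4 * growth m / growth (m + 4) = (if (m + 4) mod 3 = 1 then 1 else 8 / 9)"
proof -
  obtain q r where m: "m = r + 3 * q" and "r < 3"
    using mod_mult_div_eq[of m 3] mod_less_divisor[of 3 m] by (metis zero_less_numeral)
  note g = growth_add_mult_3[of _ q]
  have "r = 0 \<or> r = 1 \<or> r = 2" using \<open>r < 3\<close> by linarith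
  then show "2 * growth m / growth (m + 2) = (if (m + 2) mod 3 = 0 then 8 / 9 else 1)"
    "4 * growth m / growth (m + 4) = (if (m + 4) mod 3 = 1 then 1 else 8 / 9)"
    using g[of r] g[of "r + 2"] g[of "r + 4"] unfolding m
    by (auto simp: growth_numerals add.commute add.left_commute) presburger+
  show "3 * growth m / growth (m + 3) = 1"
    using growth_pos[of m] by (simp add: growth_add_3)
qed

text \<open>Equality holds at \<open>k = 7\<close>. Beyond 9, a step of 3 triples
  \<open>growth\<close> but multiplies \<open>k\<close> by less than 3.\<close>

lemma growth_ge: "7 \<le> k \<Longrightarrow> of_nat k \<le> 7 / 12 * growth k"
proof (induction k rule: less_induct)
  case (less k)
  show ?case
  proof (cases "k < 10")
    case True
    then have "k = 7 \<or> k = 8 \<or> k = 9" using less.prems by linarith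
    then show ?thesis by (auto simp: growth_numerals)
  next
    case False
    define j where "j = k - 3"
    have j: "k = Suc (Suc (Suc j))" "7 \<le> j" using False by (auto simp: j_def)
    then show ?thesis using less.IH[of j] by simp
  qed
qed

lemma growth_ratio_le:
  assumes "k \<le> n" "of_nat k \<le> c * growth k" "0 \<le> c"
  shows "of_nat k * growth (n - k) / growth n \<le> c"
proof -
  have "of_nat k * growth (n - k) \<le> c * growth k * growth (n - k)"
    using assms(2) growth_pos[of "n - k"] by (intro mult_right_mono) auto
  also have "\<dots> \<le> c * growth n"
    using growth_mult_le[of "n - k" k] assms by (simp add: mult.assoc mult.commute mult_left_mono)
  finally show ?thesis using growth_pos[of n] by (simp add: field_simps)
qed

lemma scaled_power_le:
  fixes y w c :: rat
  assumes "y ^ 80 \<le> c" "0 \<le> y" "y \<le> 1" "0 \<le> w" "80 \<le> l"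
  shows "(y * w) ^ l \<le> c * w ^ l"
proof -
  have "y ^ l \<le> y ^ 80" using assms by (intro power_decreasing) auto
  then show ?thesis unfolding power_mult_distrib using assms by (intro mult_right_mono) auto
qed

text \<open>The bases are relative losses \<open>k / growth k\<close>: \<open>3/4\<close>,
  \<open>5/6\<close>, \<open>2/3\<close>, \<open>7/12\<close> for parts 1, 5, 6, 7. The base
  \<open>8/9\<close> is the second order, and \<open>1/2\<close> is the relative size of the
  corrections to the subgroup counts. Each comparison writes a base as \<open>y\<close> times
  \<open>5/6\<close> or \<open>8/9\<close> and replaces \<open>y ^ l\<close> by a bound for
  \<open>y ^ 80\<close>.\<close>

lemma power_bounds:
  fixes l :: nat
  assumes "80 \<le> l"
  defines "a \<equiv> (8 / 9 :: rat) ^ l" and "b \<equiv> (5 / 6 :: rat) ^ l"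
  shows "a \<le> 1 / 12000" "b \<le> 1 / 2000000" "a * a \<le> b / 64" "b \<le> a / 150"
    "(3 / 4) ^ l \<le> b / 4000" "(2 / 3) ^ l \<le> b / 50000000" "(7 / 12) ^ l \<le> b / 2000000000000"
    "(1 / 2) ^ l \<le> b / 100000000000000000"
proof -
  have c: "(8 / 9) ^ 80 \<le> (1 / 12000 :: rat)" "(5 / 6) ^ 80 \<le> (1 / 2000000 :: rat)"
    "(128 / 135) ^ 80 \<le> (1 / 64 :: rat)" "(15 / 16) ^ 80 \<le> (1 / 150 :: rat)"
    "(9 / 10) ^ 80 \<le> (1 / 4000 :: rat)" "(4 / 5) ^ 80 \<le> (1 / 50000000 :: rat)"
    "(7 / 10) ^ 80 \<le> (1 / 2000000000000 :: rat)" "(3 / 5) ^ 80 \<le> (1 / 100000000000000000 :: rat)"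
    by (simp_all add: power_divide)
  show "a \<le> 1 / 12000" "b \<le> 1 / 2000000"
    using scaled_power_le[OF c(1), of 1 l] scaled_power_le[OF c(2), of 1 l] assms(1)
    unfolding a_def b_def by simp_all
  show "a * a \<le> b / 64"
    using scaled_power_le[OF c(3), of "5 / 6" l] assms(1)
    unfolding a_def b_def by (simp flip: power_mult_distrib)
  show "b \<le> a / 150"
    using scaled_power_le[OF c(4), of "8 / 9" l] assms(1) unfolding a_def b_def by simp
  show "(3 / 4) ^ l \<le> b / 4000" "(2 / 3) ^ l \<le> b / 50000000" "(7 / 12) ^ l \<le> b / 2000000000000"
    "(1 / 2) ^ l \<le> b / 100000000000000000"
    using scaled_power_le[OF c(5), of "5 / 6" l] scaled_power_le[OF c(6), of "5 / 6" l]
      scaled_power_le[OF c(7), of "5 / 6" l] scaled_power_le[OF c(8), of "5 / 6" l] assms(1)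
    unfolding b_def by simp_all
qed

text \<open>The index is shifted by 6 so that the terms missing from the recurrence for small \<open>n\<close>
  are zeros.\<close>

definition scaled_N :: "nat \<Rightarrow> nat \<Rightarrow> rat" where
  "scaled_N l i = (if i < 6 then 0 else N l (i - 6) / growth (i - 6) ^ l)"

text \<open>The coefficient of the scaled recurrence, factored into the loss caused by a part
  \<open>k\<close>, raised to the power \<open>l\<close>, and the ratio of the subgroup count to its
  bound \<open>k ^ l\<close>.\<close>

definition weight :: "nat \<Rightarrow> nat \<Rightarrow> nat \<Rightarrow> rat" where
  "weight l n k = (of_nat k * growth (n - k) / growth n) ^ l * (of_nat (subgroup_count l k) / of_nat k ^ l)"

lemma scaled_N_nonneg: "0 \<le> scaled_N l i"
  using growth_pos[of "i - 6"] by (simp add: scaled_N_def N_nonneg)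

lemma weight_nonneg: "0 \<le> weight l n k"
  using growth_pos[of n] growth_pos[of "n - k"] by (simp add: weight_def)

lemma scaled_N_rec:
  assumes "1 \<le> n" "n \<le> m"
  shows "of_nat n * scaled_N l (n + 6) = (\<Sum>k=1..m. weight l n k * scaled_N l (n + 6 - k))"
proof -
  have g: "growth j \<noteq> 0" for j using growth_pos[of j] by simp
  have "of_nat n * scaled_N l (n + 6) = (of_nat n * N l n) / growth n ^ l" by (simp add: scaled_N_def)
  also have "\<dots> = (\<Sum>k=1..n. of_nat (subgroup_count l k) * N l (n - k) / growth n ^ l)"
    unfolding N_rec[OF assms(1)] by (simp add: sum_divide_distrib)
  also have "\<dots> = (\<Sum>k=1..n. weight l n k * scaled_N l (n + 6 - k))"
  proof (rule sum.cong[OF refl])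
    fix k assume k: "k \<in> {1..n}"
    then have "n + 6 - k - 6 = n - k" "\<not> n + 6 - k < 6" by auto
    then show "of_nat (subgroup_count l k) * N l (n - k) / growth n ^ l = weight l n k * scaled_N l (n + 6 - k)"
      using k g[of n] g[of "n - k"] by (simp add: scaled_N_def weight_def power_divide power_mult_distrib)
  qed
  also have "\<dots> = (\<Sum>k=1..m. weight l n k * scaled_N l (n + 6 - k))"
    using assms(2) by (intro sum.mono_neutral_left) (auto simp: scaled_N_def)
  finally show ?thesis .
qed

lemma weight_le:
  assumes "1 \<le> l" "1 \<le> k" "k \<le> n" "of_nat k \<le> c * growth k" "0 \<le> c"
  shows "weight l n k \<le> c ^ l"
proof -
  have "weight l n k \<le> c ^ l * 1"
    unfolding weight_def
  proof (rule mult_mono[OF power_mono])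
    show "of_nat k * growth (n - k) / growth n \<le> c" using growth_ratio_le assms by blast
    show "of_nat (subgroup_count l k) / of_nat k ^ l \<le> (1::rat)"
      using subgroup_count_le[OF assms(1,2)] assms(2) by simp
    show "0 \<le> of_nat k * growth (n - k) / growth n" using growth_pos[of n] growth_pos[of "n - k"] by simp
  qed (use assms in simp_all)
  then show ?thesis by simp
qed

lemma le_growth: "of_nat k \<le> growth k"
proof (cases "7 \<le> k")
  case True
  then show ?thesis using growth_ge[of k] growth_pos[of k] by simp
next
  case False
  then have "k = 0 \<or> k = 1 \<or> k = 2 \<or> k = 3 \<or> k = 4 \<or> k = 5 \<or> k = 6" by linarith
  then show ?thesis by (auto simp: growth_numerals)
qed

text \<open>The recurrence writes \<open>n\<close> times the value as a sum of \<open>n\<close>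
  products of numbers between 0 and 1.\<close>

lemma scaled_N_le_1:
  assumes "1 \<le> l"
  shows "scaled_N l i \<le> 1"
proof (induction i rule: less_induct)
  case (less i)
  show ?case
  proof (cases "i \<le> 6")
    case True
    then show ?thesis by (cases "i = 6") (auto simp: scaled_N_def N_0)
  next
    case False
    define n where "n = i - 6"
    have n: "1 \<le> n" "i = n + 6" using False by (auto simp: n_def)
    have "of_nat n * scaled_N l i = (\<Sum>k=1..n. weight l n k * scaled_N l (n + 6 - k))"
      unfolding n(2) using n(1) by (rule scaled_N_rec) simp
    also have "\<dots> \<le> (\<Sum>k=1..n. 1)"
    proof (rule sum_mono)
      fix k assume k: "k \<in> {1..n}"
      have "weight l n k \<le> 1 ^ l" using assms k le_growth[of k] by (intro weight_le) auto
      moreover have "scaled_N l (n + 6 - k) \<le> 1" using less[of "n + 6 - k"] k n by auto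
      ultimately show "weight l n k * scaled_N l (n + 6 - k) \<le> 1"
        using weight_nonneg[of l n k] scaled_N_nonneg[of l "n + 6 - k"] by (simp add: mult_le_one)
    qed
    also have "\<dots> = of_nat n" by simp
    finally show ?thesis using n(1) by (simp add: mult_le_cancel_left1)
  qed
qed

text \<open>The second order term is needed for \<open>n = 20\<close>, where the leading terms of the two products cancel.\<close>

definition approx :: "nat \<Rightarrow> rat \<Rightarrow> rat \<times> rat \<times> rat \<Rightarrow> bool" where
  "approx l x t \<longleftrightarrow> (case t of (p, q, e) \<Rightarrow> 0 \<le> p \<and> 0 \<le> q \<and> 0 \<le> e \<and>
     \<bar>x - (p + q * (8 / 9) ^ l)\<bar> \<le> e * (5 / 6) ^ l)"

text \<open>The constants are \<open>(8/9)\<^sup>8\<^sup>0 < 1/12000\<close>, \<open>(5/6)\<^sup>8\<^sup>0 < 1/2000000\<close> and \<open>(128/135)\<^sup>8\<^sup>0 < 1/64\<close>,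
  where \<open>(8/9)\<^sup>2 = 128/135 * 5/6\<close>.\<close>

definition upper :: "rat \<times> rat \<times> rat \<Rightarrow> rat" where
  "upper = (\<lambda>(p, q, e). p + q / 12000 + e / 2000000)"

definition lower :: "rat \<times> rat \<times> rat \<Rightarrow> rat" where
  "lower = (\<lambda>(p, q, e). p - e / 2000000)"

text \<open>The effect of multiplying by \<open>(8/9)^l\<close>: the main term becomes second order,
  the second order term falls into the error by \<open>(64/81)^l \<le> (5/6)^l / 64\<close>, and the
  old error shrinks by 12000.\<close>

definition shift_order :: "rat \<times> rat \<times> rat \<Rightarrow> rat \<times> rat \<times> rat" where
  "shift_order = (\<lambda>(p, q, e). (0, p, q / 64 + e / 12000))"

lemma approx_bounds:
  assumes "80 \<le> l" "approx l x t"
  shows "lower t \<le> x" "x \<le> upper t"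
proof -
  obtain p q e where t: "t = (p, q, e)" by (cases t)
  note b = power_bounds[OF assms(1)]
  have nn: "0 \<le> q" "0 \<le> e" using assms(2) unfolding approx_def t by auto
  have "e * (5 / 6) ^ l \<le> e * (1 / 2000000)" using nn(2) b(2) by (rule mult_left_mono[rotated])
  moreover have "q * (8 / 9) ^ l \<le> q * (1 / 12000)" using nn(1) b(1) by (rule mult_left_mono[rotated])
  moreover have "0 \<le> q * (8 / 9) ^ l" using nn(1) by simp
  ultimately show "lower t \<le> x" "x \<le> upper t"
    using assms(2) unfolding approx_def t lower_def upper_def by auto
qed

lemma approx_shift_order:
  assumes "80 \<le> l" "approx l x t"
  shows "approx l ((8 / 9) ^ l * x) (shift_order t)"
proof -
  obtain p q e where t: "t = (p, q, e)" by (cases t)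
  define a where "a = (8 / 9 :: rat) ^ l"
  define b where "b = (5 / 6 :: rat) ^ l"
  note pb = power_bounds[OF assms(1), folded a_def b_def]
  have nn: "0 \<le> p" "0 \<le> q" "0 \<le> e" "\<bar>x - (p + q * a)\<bar> \<le> e * b" "0 \<le> a" "0 \<le> b"
    using assms(2) unfolding approx_def t a_def b_def by auto
  have "a * x - p * a = a * (x - (p + q * a)) + q * (a * a)" by (simp add: algebra_simps)
  also have "\<bar>\<dots>\<bar> \<le> a * \<bar>x - (p + q * a)\<bar> + q * (a * a)"
    using nn by (intro order_trans[OF abs_triangle_ineq]) (simp add: abs_mult)
  also have "\<dots> \<le> 1 / 12000 * (e * b) + q * (b / 64)"
    using nn pb by (intro add_mono mult_mono) auto
  finally have "\<bar>a * x - p * a\<bar> \<le> (q / 64 + e / 12000) * b" by (simp add: algebra_simps)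
  then show ?thesis using nn unfolding approx_def t shift_order_def a_def[symmetric] b_def[symmetric] by simp
qed

text \<open>The subgroup counts of index 2, 3, 4 are \<open>2\<^sup>l\<close>, \<open>3\<^sup>l/2\<close>, \<open>2/3 * 4\<^sup>l\<close> up to lower order; every other
  index only contributes to the error.\<close>

definition step_ok :: "nat \<Rightarrow> (nat \<Rightarrow> rat \<times> rat \<times> rat) \<Rightarrow> bool" where
  "step_ok n t \<longleftrightarrow>
    (let (p2, q2, e2) = (if n mod 3 = 0 then shift_order (t (n + 4)) else t (n + 4));
         (p3, q3, e3) = t (n + 3);
         (p4, q4, e4) = (if n mod 3 = 1 then t (n + 2) else shift_order (t (n + 2)));
         (p, q, e) = t (n + 6)
     in 0 \<le> p \<and> 0 \<le> q \<and> 0 \<le> e \<and>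
        of_nat n * p = p2 + p3 / 2 + 2 / 3 * p4 \<and> of_nat n * q = q2 + q3 / 2 + 2 / 3 * q4 \<and>
        e2 + e3 / 2 + 2 / 3 * e4 + upper (t (n + 5)) / 4000 + upper (t (n + 1)) +
          upper (t n) / 50000000 + 1 / 100000000000 \<le> of_nat n * e)"

text \<open>Parts 2, 3, 4 are kept to second order. Part 1 and all parts from 5 on enter the error
  only, being at most \<open>c ^ l\<close> with \<open>c\<close> equal to \<open>3/4\<close>,
  \<open>5/6\<close>, \<open>2/3\<close>, and \<open>7/12\<close> from part 7 on. As
  \<open>n \<le> 21\<close>, a sum up to 21 always suffices.\<close>

lemma approx_step:
  assumes l: "80 \<le> l" and n: "1 \<le> n" "n \<le> 21"
    and t: "\<And>i. i < n + 6 \<Longrightarrow> approx l (scaled_N l i) (t i)" and ok: "step_ok n t"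
  shows "approx l (scaled_N l (n + 6)) (t (n + 6))"
proof -
  define a where "a = (8 / 9 :: rat) ^ l"
  define b where "b = (5 / 6 :: rat) ^ l"
  note pb = power_bounds[OF l, folded a_def b_def]
  have ab: "0 \<le> a" "0 \<le> b" by (auto simp: a_def b_def)
  let ?z = "scaled_N l"
  define T where "T k = weight l n k * ?z (n + 6 - k)" for k
  have l1: "1 \<le> l" using l by simp
  have z: "0 \<le> ?z i" "?z i \<le> 1" for i using scaled_N_nonneg scaled_N_le_1[OF l1] by auto
  have up: "?z i \<le> upper (t i)" if "i < n + 6" for i using approx_bounds(2)[OF l t[OF that]] .
  have T0: "0 \<le> T k" for k using weight_nonneg z by (simp add: T_def)
  have Tle: "T k \<le> c ^ l * ?z (n + 6 - k)" if "1 \<le> k" "of_nat k \<le> c * growth k" "0 \<le> c" for k c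
  proof (cases "k \<le> n")
    case True
    then show ?thesis unfolding T_def
      using weight_le[OF l1 that(1) True that(2,3)] z by (intro mult_right_mono) auto
  next
    case False
    then have "n + 6 - k < 6" by simp
    then show ?thesis by (simp add: T_def scaled_N_def)
  qed
  have sum: "of_nat n * ?z (n + 6) = T 1 + T 2 + T 3 + T 4 + T 5 + T 6 + (\<Sum>k=7..21. T k)"
  proof -
    have "{1..21} = {1, 2, 3, 4, 5, 6} \<union> {7..21::nat}" by auto
    then have "(\<Sum>k=1..21. T k) = (\<Sum>k\<in>{1, 2, 3, 4, 5, 6}. T k) + (\<Sum>k=7..21. T k)"
      by (simp only:) (rule sum.union_disjoint, auto)
    then show ?thesis using scaled_N_rec[OF n, of l, folded T_def] by simp
  qed
  have T1: "T 1 \<le> upper (t (n + 5)) * b / 4000"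
  proof -
    have "T 1 \<le> (3 / 4) ^ l * ?z (n + 5)" using Tle[of 1 "3/4"] by (simp add: add.commute)
    also have "\<dots> \<le> b / 4000 * upper (t (n + 5))"
      using pb(5) up[of "n + 5"] z(1)[of "n + 5"] ab by (intro mult_mono) auto
    finally show ?thesis by (simp add: mult.commute)
  qed
  have T5: "T 5 \<le> upper (t (n + 1)) * b"
  proof -
    have "T 5 \<le> b * ?z (n + 1)" using Tle[of 5 "5/6"] by (simp add: growth_numerals b_def add.commute)
    also have "\<dots> \<le> b * upper (t (n + 1))" using up[of "n + 1"] ab by (intro mult_left_mono) auto
    finally show ?thesis by (simp add: mult.commute)
  qed
  have T6: "T 6 \<le> upper (t n) * b / 50000000"
  proof -
    have "T 6 \<le> (2 / 3) ^ l * ?z n" using Tle[of 6 "2/3"] by (simp add: growth_numerals add.commute)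
    also have "\<dots> \<le> b / 50000000 * upper (t n)"
      using pb(6) up[of n] z(1)[of n] ab by (intro mult_mono) auto
    finally show ?thesis by (simp add: mult.commute)
  qed
  have T7: "(\<Sum>k=7..21. T k) \<le> 15 / 2000000000000 * b"
  proof -
    have "(\<Sum>k=7..21. T k) \<le> (\<Sum>k=7..21::nat. b / 2000000000000)"
    proof (rule sum_mono)
      fix k :: nat assume "k \<in> {7..21}"
      then have "T k \<le> (7 / 12) ^ l * ?z (n + 6 - k)" using growth_ge[of k] by (intro Tle) auto
      also have "\<dots> \<le> b / 2000000000000 * 1" using pb(7) z ab by (intro mult_mono) auto
      finally show "T k \<le> b / 2000000000000" by simp
    qed
    then show ?thesis by simp
  qed
  obtain p2 q2 e2 where t2: "(if n mod 3 = 0 then shift_order (t (n + 4)) else t (n + 4)) = (p2, q2, e2)"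
    by (metis prod_cases3)
  obtain p3 q3 e3 where t3: "t (n + 3) = (p3, q3, e3)" by (metis prod_cases3)
  obtain p4 q4 e4 where t4: "(if n mod 3 = 1 then t (n + 2) else shift_order (t (n + 2))) = (p4, q4, e4)"
    by (metis prod_cases3)
  obtain p q e where t6: "t (n + 6) = (p, q, e)" by (metis prod_cases3)
  define x2 where "x2 = (if n mod 3 = 0 then a else 1) * ?z (n + 4)"
  define x3 where "x3 = ?z (n + 3)"
  define x4 where "x4 = (if n mod 3 = 1 then 1 else a) * ?z (n + 2)"
  have a1: "a \<le> 1" using pb(1) by simp
  have x: "0 \<le> x2" "x2 \<le> 1" "0 \<le> x3" "x3 \<le> 1" "0 \<le> x4" "x4 \<le> 1"
    unfolding x2_def x3_def x4_def using z ab a1 by (auto intro: mult_le_one)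
  have ap2: "approx l x2 (p2, q2, e2)"
    unfolding t2[symmetric] x2_def a_def using t[of "n + 4"] approx_shift_order[OF l t[of "n + 4"]] by simp
  have ap3: "approx l x3 (p3, q3, e3)"
    unfolding t3[symmetric] x3_def using t[of "n + 3"] by simp
  have ap4: "approx l x4 (p4, q4, e4)"
    unfolding t4[symmetric] x4_def a_def using t[of "n + 2"] approx_shift_order[OF l t[of "n + 2"]] by simp
  have w: "T 2 = (1 - (1 / 2) ^ l) * x2" "T 3 = (1 - (1 / 3) ^ l) / 2 * x3"
    "T 4 = (2 - 3 * (1 / 2) ^ l + (1 / 4) ^ l) / 3 * x4"
  \<comment> \<open>The exact subgroup counts divided by \<open>2^l\<close>, \<open>3^l\<close>,
    \<open>4^l\<close>. If \<open>n\<close> is smaller than the part, both sides contain a vanishing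
    \<open>scaled_N\<close>.\<close>
  proof -
    have p: "(2 ^ l - 1) / 2 ^ l = (1 - (1 / 2) ^ l :: rat)" "(3 ^ l - 1) / 2 / 3 ^ l = ((1 - (1 / 3) ^ l) / 2 :: rat)"
      by (simp_all add: power_one_over inverse_eq_divide field_simps)
    have "(2::rat) ^ l / 4 ^ l = (1 / 2) ^ l" by (simp flip: power_divide)
    then have p4: "(2 * 4 ^ l - 3 * 2 ^ l + 1) / 3 / 4 ^ l = ((2 - 3 * (1 / 2) ^ l + (1 / 4) ^ l) / 3 :: rat)"
      by (simp add: power_one_over inverse_eq_divide field_simps)
    show "T 2 = (1 - (1 / 2) ^ l) * x2"
    proof (cases "2 \<le> n")
      case True
      then have "n - 2 + 2 = n" by simp
      note r = growth_ratio(1)[of "n - 2", unfolded this]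
      have "weight l n 2 = (if n mod 3 = 0 then 8 / 9 else 1) ^ l * (1 - (1 / 2) ^ l)"
        unfolding weight_def subgroup_count_2 of_nat_numeral r p ..
      then show ?thesis by (simp add: T_def x2_def a_def add.commute)
    qed (simp add: T_def x2_def scaled_N_def)
    show "T 3 = (1 - (1 / 3) ^ l) / 2 * x3"
    proof (cases "3 \<le> n")
      case True
      then have "n - 3 + 3 = n" by simp
      note r = growth_ratio(2)[of "n - 3", unfolded this]
      have "weight l n 3 = 1 ^ l * ((1 - (1 / 3) ^ l) / 2)"
        unfolding weight_def subgroup_count_3 of_nat_numeral r p ..
      then show ?thesis by (simp add: T_def x3_def add.commute)
    qed (simp add: T_def x3_def scaled_N_def)
    show "T 4 = (2 - 3 * (1 / 2) ^ l + (1 / 4) ^ l) / 3 * x4"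
    proof (cases "4 \<le> n")
      case True
      then have "n - 4 + 4 = n" by simp
      note r = growth_ratio(3)[of "n - 4", unfolded this]
      have "weight l n 4 = (if n mod 3 = 1 then 1 else 8 / 9) ^ l * ((2 - 3 * (1 / 2) ^ l + (1 / 4) ^ l) / 3)"
        unfolding weight_def subgroup_count_4 of_nat_numeral r p4 ..
      then show ?thesis by (simp add: T_def x4_def a_def add.commute)
    qed (simp add: T_def x4_def scaled_N_def)
  qed
  define h where "h = (1 / 2 :: rat) ^ l"
  have h: "0 \<le> h" "h \<le> b / 100000000000000000" using pb(8) by (auto simp: h_def)
  have h34: "0 \<le> (1 / 3 :: rat) ^ l" "(1 / 3 :: rat) ^ l \<le> h" "0 \<le> (1 / 4 :: rat) ^ l" "(1 / 4 :: rat) ^ l \<le> h"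
    unfolding h_def by (auto intro!: power_mono)
  have d2: "\<bar>T 2 - x2\<bar> \<le> h"
  proof -
    have "T 2 - x2 = - (h * x2)" unfolding w(1) h_def by (simp add: algebra_simps)
    then show ?thesis using h(1) x mult_left_le[of x2 h] by (simp add: abs_mult)
  qed
  have d3: "\<bar>T 3 - x3 / 2\<bar> \<le> h"
  proof -
    have "(1 - u) / 2 * x - x / 2 = - (u / 2 * x)" for u x :: rat by (simp add: field_simps)
    then have "T 3 - x3 / 2 = - ((1 / 3) ^ l / 2 * x3)" unfolding w(2) .
    moreover have "(1 / 3) ^ l / 2 * x3 \<le> h * 1" using h34 h(1) x by (intro mult_mono) auto
    ultimately show ?thesis using h34 x by (simp add: abs_mult)
  qed
  have d4: "\<bar>T 4 - 2 / 3 * x4\<bar> \<le> h"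
  proof -
    have "(2 - 3 * u + v) / 3 * x - 2 / 3 * x = - ((3 * u - v) / 3 * x)" for u v x :: rat
      by (simp add: field_simps)
    then have "T 4 - 2 / 3 * x4 = - ((3 * h - (1 / 4) ^ l) / 3 * x4)" unfolding w(3) h_def .
    moreover have "(3 * h - (1 / 4) ^ l) / 3 * x4 \<le> h * 1" using h34 h(1) x by (intro mult_mono) auto
    moreover have "0 \<le> (3 * h - (1 / 4) ^ l) / 3 * x4" using h34 h(1) x by simp
    ultimately show ?thesis by simp
  qed
  from ok have ok: "0 \<le> p" "0 \<le> q" "0 \<le> e" "of_nat n * p = p2 + p3 / 2 + 2 / 3 * p4"
    "of_nat n * q = q2 + q3 / 2 + 2 / 3 * q4"
    "e2 + e3 / 2 + 2 / 3 * e4 + upper (t (n + 5)) / 4000 + upper (t (n + 1)) +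
          upper (t n) / 50000000 + 1 / 100000000000 \<le> of_nat n * e"
    unfolding step_ok_def t2 t3 t4 t6 by auto
  have Tsum: "0 \<le> (\<Sum>k=7..21. T k)" using T0 by (simp add: sum_nonneg)
  define P where "P = p2 + q2 * a + (p3 + q3 * a) / 2 + 2 / 3 * (p4 + q4 * a)"
  have x234: "\<bar>x2 - (p2 + q2 * a)\<bar> \<le> e2 * b" "\<bar>x3 - (p3 + q3 * a)\<bar> \<le> e3 * b" "\<bar>x4 - (p4 + q4 * a)\<bar> \<le> e4 * b"
    using ap2 ap3 ap4 unfolding approx_def a_def b_def by auto
  \<comment> \<open>All powers are replaced by variables, which leaves a problem of linear
    arithmetic.\<close>
  have arith: "\<bar>t1 + t2 + t3 + t4 + t5 + t6 + t7 - (y2 + y3 / 2 + 2 / 3 * y4)\<bar> \<le>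
      f2 + f3 / 2 + 2 / 3 * f4 + c1 + c5 + c6 + c7 + 3 * h"
    if "\<bar>x2 - y2\<bar> \<le> f2" "\<bar>x3 - y3\<bar> \<le> f3" "\<bar>x4 - y4\<bar> \<le> f4"
      "\<bar>t2 - x2\<bar> \<le> h" "\<bar>t3 - x3 / 2\<bar> \<le> h" "\<bar>t4 - 2 / 3 * x4\<bar> \<le> h"
      "0 \<le> t1" "t1 \<le> c1" "0 \<le> t5" "t5 \<le> c5" "0 \<le> t6" "t6 \<le> c6" "0 \<le> t7" "t7 \<le> c7"
    for t1 t2 t3 t4 t5 t6 t7 y2 y3 y4 f2 f3 f4 c1 c5 c6 c7 :: rat
    using that by linarith
  have "\<bar>of_nat n * ?z (n + 6) - P\<bar> \<le>
      e2 * b + e3 * b / 2 + 2 / 3 * (e4 * b) + upper (t (n + 5)) * b / 4000 + upper (t (n + 1)) * b +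
      upper (t n) * b / 50000000 + 15 / 2000000000000 * b + 3 * h"
    unfolding sum P_def by (rule arith[OF x234 d2 d3 d4 T0 T1 T0 T5 T0 T6 Tsum T7])
  \<comment> \<open>The parts from 7 on and the term \<open>3 * h\<close> together are at most
    \<open>(15/(2 * 10^12) + 3/10^17) * b\<close>, which the constant \<open>1/10^11\<close>
    covers.\<close>
  also have "\<dots> \<le> (e2 + e3 / 2 + 2 / 3 * e4 + upper (t (n + 5)) / 4000 + upper (t (n + 1)) +
          upper (t n) / 50000000 + 1 / 100000000000) * b"
    using h by (simp add: algebra_simps)
  also have "\<dots> \<le> of_nat n * e * b" using ok(6) ab(2) by (rule mult_right_mono)
  finally have main: "\<bar>of_nat n * ?z (n + 6) - P\<bar> \<le> of_nat n * (e * b)" by simp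
  have "P = of_nat n * p + of_nat n * q * a"
    unfolding P_def ok(4,5) by (simp add: algebra_simps add_divide_distrib)
  then have "P = of_nat n * (p + q * a)" by (simp add: algebra_simps)
  then have "of_nat n * \<bar>?z (n + 6) - (p + q * a)\<bar> \<le> of_nat n * (e * b)"
    using main by (simp add: abs_mult right_diff_distrib[symmetric])
  then have "\<bar>?z (n + 6) - (p + q * a)\<bar> \<le> e * b"
    using n(1) by (simp add: mult_le_cancel_left)
  then show ?thesis using ok(1-3) unfolding approx_def t6 a_def b_def by simp
qed

text \<open>Entry \<open>i\<close> describes \<open>N l (i - 6)\<close>, starting from the exact
  value at 6. The first two components are forced by the equations in \<open>step_ok\<close>; the
  third is a rounded-up solution of its inequality.\<close>

definition approx_table :: "(rat \<times> rat \<times> rat) list" where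
  "approx_table =
    [(0, 0, 0), (0, 0, 0), (0, 0, 0), (0, 0, 0), (0, 0, 0), (0, 0, 0),
     (1, 0, 0), (0, 0, 13 / 50000), (1 / 2, 0, 51 / 10000000000000), (1 / 6, 0, 21 / 500000),
     (7 / 24, 0, 43 / 1000000), (1 / 12, 0, 21 / 100), (1 / 72, 5 / 48, 7 / 1000000),
     (7 / 144, 0, 11 / 100), (1 / 144, 43 / 1152, 17 / 500), (1 / 1296, 5 / 288, 33 / 1000),
     (7 / 1728, 41 / 3840, 9 / 500), (1 / 2592, 43 / 6912, 59 / 10000),
     (1 / 31104, 5 / 3456, 11 / 2000), (7 / 31104, 41 / 23040, 17 / 5000),
     (1 / 62208, 43 / 82944, 67 / 100000), (1 / 933120, 5 / 62208, 23 / 50000),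
     (7 / 746496, 41 / 276480, 41 / 100000), (1 / 1866240, 43 / 1492992, 1 / 20000),
     (1 / 33592320, 5 / 1492992, 13 / 500000), (7 / 22394880, 41 / 4976640, 31 / 1000000),
     (1 / 67184640, 43 / 35831808, 27 / 10000000), (1 / 1410877440, 1 / 8957952, 11 / 10000000)]"

lemma approx_table_step: "\<forall>n\<in>{1, 2, 3, 4, 5, 6, 7, 8, 9, 10, 11, 12, 13, 14, 15, 16, 17, 18, 19, 20, 21}.
    step_ok n ((!) approx_table)"
  by (simp add: step_ok_def approx_table_def upper_def shift_order_def)

lemma approx_scaled_N:
  assumes "80 \<le> l" "i < 28"
  shows "approx l (scaled_N l i) (approx_table ! i)"
  using assms(2)
proof (induction i rule: less_induct)
  case (less i)
  consider "i < 6" | "i = 6" | "7 \<le> i" by linarith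
  then show ?case
  proof cases
    case 1
    then have "i = 0 \<or> i = 1 \<or> i = 2 \<or> i = 3 \<or> i = 4 \<or> i = 5" by linarith
    then show ?thesis by (auto simp: approx_def approx_table_def scaled_N_def)
  next
    case 2
    then show ?thesis by (simp add: approx_def approx_table_def scaled_N_def N_0)
  next
    case 3
    define n where "n = i - 6"
    have n: "1 \<le> n" "n \<le> 21" "i = n + 6" using 3 less.prems by (auto simp: n_def)
    have "n \<in> {1, 2, 3, 4, 5, 6, 7, 8, 9, 10, 11, 12, 13, 14, 15, 16, 17, 18, 19, 20, 21}"
      using n(1,2) by (simp only: insert_iff empty_iff) presburger
    with approx_table_step have "step_ok n ((!) approx_table)" by (rule bspec)
    then show ?thesis unfolding n(3) using less n by (intro approx_step[OF assms(1) n(1,2)]) auto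
  qed
qed

section \<open>Signs from the asymptotic expansion\<close>

lemma Delta_scaled:
  assumes "2 \<le> n"
  shows "Delta l n = (growth n ^ l) ^ 2 * (scaled_N l (n + 6) ^ 2 -
    (growth (n - 1) * growth (n + 1) / growth n ^ 2) ^ l * (scaled_N l (n + 5) * scaled_N l (n + 7)))"
proof -
  have g: "growth j \<noteq> 0" for j using growth_pos[of j] by simp
  have "n + 6 - 6 = n" "n + 5 - 6 = n - 1" "n + 7 - 6 = n + 1" "\<not> n + 5 < 6" using assms by auto
  then have "scaled_N l (n + 6) = N l n / growth n ^ l"
    "scaled_N l (n + 5) = N l (n - 1) / growth (n - 1) ^ l"
    "scaled_N l (n + 7) = N l (n + 1) / growth (n + 1) ^ l"
    unfolding scaled_N_def by simp_all
  moreover have "((growth n ^ 2) ^ l) = (growth n ^ l) ^ 2" by (simp flip: power_mult add: mult.commute)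
  ultimately show ?thesis
    using g[of n] g[of "n - 1"] g[of "n + 1"]
    by (simp add: Delta_def power_divide power_mult_distrib right_diff_distrib)
qed

lemma growth_log_ratio:
  assumes "1 \<le> n"
  shows "growth (n - 1) * growth (n + 1) / growth n ^ 2 =
    (if n mod 3 = 0 then 8 / 9 else if n mod 3 = 1 then 9 / 8 else 1)"
proof -
  have "growth m * growth (m + 2) / growth (m + 1) ^ 2 =
      (if (m + 1) mod 3 = 0 then 8 / 9 else if (m + 1) mod 3 = 1 then 9 / 8 else 1)" for m
  proof -
    obtain q r where m: "m = r + 3 * q" and "r < 3"
      using mod_mult_div_eq[of m 3] mod_less_divisor[of 3 m] by (metis zero_less_numeral)
    have "growth m = 3 ^ q * growth r" "growth (m + 1) = 3 ^ q * growth (r + 1)"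
      "growth (m + 2) = 3 ^ q * growth (r + 2)"
      using growth_add_mult_3[of r q] growth_add_mult_3[of "r + 1" q] growth_add_mult_3[of "r + 2" q]
      unfolding m by (simp_all add: add.commute add.left_commute)
    moreover have "(m + 1) mod 3 = (r + 1) mod 3" unfolding m by presburger
    moreover have "r = 0 \<or> r = 1 \<or> r = 2" using \<open>r < 3\<close> by linarith
    ultimately show ?thesis by (auto simp: growth_numerals power2_eq_square) presburger
  qed
  moreover have "n - 1 + 1 = n" "n - 1 + 2 = n + 1" using assms by auto
  ultimately show ?thesis by metis
qed

text \<open>Second order terms multiply to \<open>q * s * a^2\<close>, which is moved into the
  error. The lower bound drops the nonnegative terms in \<open>a^2\<close> and \<open>b^2\<close>;
  it needs nonnegative lower ends, because two lower bounds are multiplied.\<close>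

lemma approx_mult_bounds:
  assumes l: "80 \<le> l" and x: "approx l x (p, q, e)" and y: "approx l y (r, s, f)"
    and xy: "0 \<le> x" "0 \<le> y"
  defines "a \<equiv> (8 / 9 :: rat) ^ l" and "b \<equiv> (5 / 6 :: rat) ^ l"
  shows "x * y \<le> p * r + (p * s + q * r) * a +
      (q * s / 64 + e * (r + s / 12000) + f * (p + q / 12000) + e * f / 2000000) * b"
    and "0 \<le> lower (p, q, e) \<Longrightarrow> 0 \<le> lower (r, s, f) \<Longrightarrow>
      p * r + (p * s + q * r) * a - (e * (r + s / 12000) + f * (p + q / 12000)) * b \<le> x * y"
proof -
  note pb = power_bounds[OF l, folded a_def b_def]
  have ab: "0 \<le> a" "0 \<le> b" by (auto simp: a_def b_def)
  have nn: "0 \<le> p" "0 \<le> q" "0 \<le> e" "0 \<le> r" "0 \<le> s" "0 \<le> f"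
    using x y by (auto simp: approx_def)
  have xb: "x \<le> (p + q * a) + e * b" "(p + q * a) - e * b \<le> x"
    and yb: "y \<le> (r + s * a) + f * b" "(r + s * a) - f * b \<le> y"
    using x y by (auto simp: approx_def a_def b_def abs_le_iff)
  define u where "u = p + q * a"
  define v where "v = r + s * a"
  have u: "0 \<le> u" "u \<le> p + q / 12000" unfolding u_def using nn ab mult_left_mono[OF pb(1) nn(2)] by auto
  have v: "0 \<le> v" "v \<le> r + s / 12000" unfolding v_def using nn ab mult_left_mono[OF pb(1) nn(5)] by auto
  have uv: "u * v = p * r + (p * s + q * r) * a + q * s * (a * a)"
    unfolding u_def v_def by (simp add: algebra_simps)
  have eb: "e * b * v \<le> e * (r + s / 12000) * b" "f * b * u \<le> f * (p + q / 12000) * b"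
    using mult_left_mono[OF v(2), of "e * b"] mult_left_mono[OF u(2), of "f * b"] nn ab
    by (auto simp: mult.commute mult.left_commute)
  {
    assume "0 \<le> lower (p, q, e)" "0 \<le> lower (r, s, f)"
    then have "e * b \<le> p" "f * b \<le> r"
      using mult_left_mono[OF pb(2) nn(3)] mult_left_mono[OF pb(2) nn(6)] by (auto simp: lower_def)
    then have "0 \<le> u - e * b" "0 \<le> v - f * b"
      unfolding u_def v_def using nn ab by (auto simp: add_increasing2)
    then have "(u - e * b) * (v - f * b) \<le> x * y"
      using xb(2) yb(2) unfolding u_def[symmetric] v_def[symmetric] by (intro mult_mono) auto
    moreover have "(u - e * b) * (v - f * b) = u * v - e * b * v - f * b * u + (e * b) * (f * b)"
      by (simp add: algebra_simps)
    moreover have "0 \<le> (e * b) * (f * b)" "0 \<le> q * s * (a * a)" using nn ab by auto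
    ultimately show "p * r + (p * s + q * r) * a - (e * (r + s / 12000) + f * (p + q / 12000)) * b \<le> x * y"
      using eb unfolding uv distrib_right[of _ _ b] by linarith
  }
  show "x * y \<le> p * r + (p * s + q * r) * a +
      (q * s / 64 + e * (r + s / 12000) + f * (p + q / 12000) + e * f / 2000000) * b"
  proof -
    have "x * y \<le> (u + e * b) * (v + f * b)"
      using xb(1) yb(1) xy u(1) nn ab unfolding u_def[symmetric] v_def[symmetric] by (intro mult_mono) auto
    also have "\<dots> = u * v + e * b * v + f * b * u + e * f * (b * b)" by (simp add: algebra_simps)
    also have "\<dots> \<le> (p * r + (p * s + q * r) * a + q * s / 64 * b) + e * (r + s / 12000) * b +
        f * (p + q / 12000) * b + e * f / 2000000 * b"
    proof (intro add_mono eb)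
      have "q * s * (a * a) \<le> q * s * (b / 64)" using pb(3) nn by (intro mult_left_mono) auto
      then show "u * v \<le> p * r + (p * s + q * r) * a + q * s / 64 * b" unfolding uv by simp
      have "e * f * (b * b) \<le> e * f * (1 / 2000000 * b)"
        using pb(2) nn ab by (intro mult_left_mono mult_right_mono) auto
      then show "e * f * (b * b) \<le> e * f / 2000000 * b" by simp
    qed
    also have "\<dots> = p * r + (p * s + q * r) * a +
        (q * s / 64 + e * (r + s / 12000) + f * (p + q / 12000) + e * f / 2000000) * b"
      by (simp only: distrib_right add.assoc)
    finally show ?thesis .
  qed
qed

text \<open>For \<open>n \<equiv> 2\<close> modulo 3 below 20. The main terms favour the square
  while the second order works against it, so its worst case replaces \<open>(8/9)^l\<close> by
  \<open>1/12000\<close> and \<open>(5/6)^l\<close> by \<open>1/2000000\<close>.\<close>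

definition pos_gap :: "rat \<times> rat \<times> rat \<Rightarrow> rat \<times> rat \<times> rat \<Rightarrow> rat \<times> rat \<times> rat \<Rightarrow> bool" where
  "pos_gap = (\<lambda>(p, q, e) (r, s, f) (r', s', f').
     0 \<le> lower (p, q, e) \<and> 2 * (p * q) \<le> r * s' + s * r' \<and>
     (2 * (e * (p + q / 12000)) + s * s' / 64 + f * (r' + s' / 12000) + f' * (r + s / 12000) +
       f * f' / 2000000) / 2000000 \<le> (p * p - r * r') + (2 * (p * q) - (r * s' + s * r')) / 12000)"

text \<open>For \<open>n = 20\<close>. The main terms cancel, so the second order difference has to
  beat the errors; 150 is the factor by which \<open>(8/9)^l\<close> exceeds \<open>(5/6)^l\<close>
  at least.\<close>

definition neg_gap :: "rat \<times> rat \<times> rat \<Rightarrow> rat \<times> rat \<times> rat \<Rightarrow> rat \<times> rat \<times> rat \<Rightarrow> bool" where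
  "neg_gap = (\<lambda>(p, q, e) (r, s, f) (r', s', f').
     0 \<le> lower (r, s, f) \<and> 0 \<le> lower (r', s', f') \<and> p * p = r * r' \<and>
     (q * q / 64 + 2 * (e * (p + q / 12000)) + e * e / 2000000 + f * (r' + s' / 12000) +
       f' * (r + s / 12000)) / 150 < r * s' + s * r' - 2 * (p * q))"

lemma Delta_large_l_iff:
  assumes "2 \<le> n"
  shows "Delta l n < 0 \<longleftrightarrow> scaled_N l (n + 6) * scaled_N l (n + 6) <
    (if n mod 3 = 0 then 8 / 9 else if n mod 3 = 1 then 9 / 8 else 1) ^ l *
      (scaled_N l (n + 5) * scaled_N l (n + 7))"
proof -
  have "0 < (growth n ^ l) ^ 2" using growth_pos[of n] by simp
  moreover have "1 \<le> n" using assms by simp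
  ultimately show ?thesis
    unfolding Delta_scaled[OF assms] growth_log_ratio[OF \<open>1 \<le> n\<close>] power2_eq_square[of "scaled_N l (n + 6)"]
    by (simp only: mult_less_0_iff) auto
qed

lemma Delta_large_l:
  assumes l: "80 \<le> l" and n: "2 \<le> n" "n \<le> 20"
  defines "x \<equiv> approx_table ! (n + 6)" and "y \<equiv> approx_table ! (n + 5)" and "z \<equiv> approx_table ! (n + 7)"
  shows "n mod 3 = 0 \<Longrightarrow> 0 \<le> lower x \<Longrightarrow> upper y * upper z / 12000 \<le> lower x * lower x \<Longrightarrow> \<not> Delta l n < 0"
    and "n mod 3 = 1 \<Longrightarrow> 0 \<le> lower y \<Longrightarrow> 0 \<le> lower z \<Longrightarrow> upper x * upper x / 12000 < lower y * lower z \<Longrightarrow>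
      Delta l n < 0"
    and "n mod 3 = 2 \<Longrightarrow> pos_gap x y z \<Longrightarrow> \<not> Delta l n < 0"
    and "n mod 3 = 2 \<Longrightarrow> neg_gap x y z \<Longrightarrow> Delta l n < 0"
proof -
  define a where "a = (8 / 9 :: rat) ^ l"
  define b where "b = (5 / 6 :: rat) ^ l"
  note pb = power_bounds[OF l, folded a_def b_def]
  have ab: "0 < a" "0 < b" by (auto simp: a_def b_def)
  let ?X = "scaled_N l (n + 6)" and ?Y = "scaled_N l (n + 5)" and ?Z = "scaled_N l (n + 7)"
  have X: "approx l ?X x" and Y: "approx l ?Y y" and Z: "approx l ?Z z"
    unfolding x_def y_def z_def using n by (auto intro!: approx_scaled_N[OF l])
  note bX = approx_bounds[OF l X] and bY = approx_bounds[OF l Y] and bZ = approx_bounds[OF l Z]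
  have nn: "0 \<le> ?X" "0 \<le> ?Y" "0 \<le> ?Z" by (rule scaled_N_nonneg)+
  {
    assume m: "n mod 3 = 0" and *: "0 \<le> lower x" "upper y * upper z / 12000 \<le> lower x * lower x"
    have "a * (?Y * ?Z) \<le> 1 / 12000 * (upper y * upper z)"
      using pb(1) ab nn bY bZ by (intro mult_mono) auto
    also have "\<dots> \<le> lower x * lower x" using *(2) by simp
    also have "\<dots> \<le> ?X * ?X" using *(1) bX nn by (intro mult_mono) auto
    finally show "\<not> Delta l n < 0" unfolding Delta_large_l_iff[OF n(1)] a_def using m by simp
  next
    assume m: "n mod 3 = 1" and *: "0 \<le> lower y" "0 \<le> lower z" "upper x * upper x / 12000 < lower y * lower z"
    have "a * (?X * ?X) \<le> 1 / 12000 * (upper x * upper x)"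
      using pb(1) ab nn bX by (intro mult_mono) auto
    also have "\<dots> < lower y * lower z" using *(3) by simp
    also have "\<dots> \<le> ?Y * ?Z" using *(1,2) bY bZ nn by (intro mult_mono) auto
    finally have "(9 / 8) ^ l * (a * (?X * ?X)) < (9 / 8) ^ l * (?Y * ?Z)" by (intro mult_strict_left_mono) auto
    moreover have "(9 / 8) ^ l * a = 1" unfolding a_def by (simp flip: power_mult_distrib)
    ultimately show "Delta l n < 0"
      unfolding Delta_large_l_iff[OF n(1)] using m by (simp flip: mult.assoc)
  next
    assume m: "n mod 3 = 2" and *: "pos_gap x y z"
    obtain p q e where x: "x = (p, q, e)" by (cases x)
    obtain r s f where y: "y = (r, s, f)" by (cases y)
    obtain r' s' f' where z: "z = (r', s', f')" by (cases z)
    define D1 where "D1 = 2 * (p * q) - (r * s' + s * r')"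
    define F1 where "F1 = 2 * (e * (p + q / 12000))"
    define F2 where "F2 = s * s' / 64 + f * (r' + s' / 12000) + f' * (r + s / 12000) + f * f' / 2000000"
    have g: "0 \<le> lower (p, q, e)" "D1 \<le> 0" "(F1 + F2) / 2000000 \<le> (p * p - r * r') + D1 / 12000"
      using * unfolding x y z pos_gap_def D1_def F1_def F2_def by (auto simp: add.assoc)
    have "p * p + (p * q + q * p) * a - (e * (p + q / 12000) + e * (p + q / 12000)) * b \<le> ?X * ?X"
      using approx_mult_bounds(2)[OF l X[unfolded x] X[unfolded x] nn(1,1) g(1,1)] unfolding a_def b_def .
    then have 1: "p * p + 2 * (p * q) * a - F1 * b \<le> ?X * ?X" by (simp add: F1_def algebra_simps)
    have 2: "?Y * ?Z \<le> r * r' + (r * s' + s * r') * a + F2 * b"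
      using approx_mult_bounds(1)[OF l Y[unfolded y] Z[unfolded z] nn(2,3)] unfolding a_def b_def F2_def .
    have "0 \<le> F1 + F2"
      using X Y Z unfolding x y z approx_def F1_def F2_def by auto
    then have "(F1 + F2) * b \<le> (F1 + F2) / 2000000"
      using mult_left_mono[OF pb(2), of "F1 + F2"] by simp
    also note g(3)
    also have "D1 / 12000 \<le> D1 * a" using mult_left_mono_neg[OF pb(1) g(2)] by simp
    finally have "(F1 + F2) * b \<le> (p * p - r * r') + D1 * a" by simp
    then have "?Y * ?Z \<le> ?X * ?X" using 1 2 unfolding D1_def by (simp add: algebra_simps)
    then show "\<not> Delta l n < 0" unfolding Delta_large_l_iff[OF n(1)] using m by simp
  next
    assume m: "n mod 3 = 2" and *: "neg_gap x y z"
    obtain p q e where x: "x = (p, q, e)" by (cases x)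
    obtain r s f where y: "y = (r, s, f)" by (cases y)
    obtain r' s' f' where z: "z = (r', s', f')" by (cases z)
    define D1 where "D1 = r * s' + s * r' - 2 * (p * q)"
    define F1 where "F1 = q * q / 64 + 2 * (e * (p + q / 12000)) + e * e / 2000000"
    define F2 where "F2 = f * (r' + s' / 12000) + f' * (r + s / 12000)"
    have g: "0 \<le> lower (r, s, f)" "0 \<le> lower (r', s', f')" "p * p = r * r'" "(F1 + F2) / 150 < D1"
      using * unfolding x y z neg_gap_def D1_def F1_def F2_def by (auto simp: add.assoc)
    have 1: "r * r' + (r * s' + s * r') * a - F2 * b \<le> ?Y * ?Z"
      using approx_mult_bounds(2)[OF l Y[unfolded y] Z[unfolded z] nn(2,3) g(1,2)] unfolding a_def b_def F2_def .
    have "?X * ?X \<le> p * p + (p * q + q * p) * a +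
        (q * q / 64 + e * (p + q / 12000) + e * (p + q / 12000) + e * e / 2000000) * b"
      using approx_mult_bounds(1)[OF l X[unfolded x] X[unfolded x] nn(1,1)] unfolding a_def b_def .
    then have 2: "?X * ?X \<le> p * p + 2 * (p * q) * a + F1 * b" by (simp add: F1_def algebra_simps)
    have "0 \<le> F1 + F2"
      using X Y Z unfolding x y z approx_def F1_def F2_def by auto
    then have "(F1 + F2) * b \<le> (F1 + F2) / 150 * a"
      using mult_left_mono[OF pb(4), of "F1 + F2"] by simp
    also have "\<dots> < D1 * a" using g(4) ab(1) by (rule mult_strict_right_mono)
    finally have "?X * ?X < ?Y * ?Z" using 1 2 g(3) unfolding D1_def by (simp add: algebra_simps)
    then show "Delta l n < 0" unfolding Delta_large_l_iff[OF n(1)] using m by simp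
  }
qed

lemma Delta_large_l_exc_set:
  assumes "80 \<le> l" "2 \<le> n" "n \<le> 20"
  shows "Delta l n < 0 \<longleftrightarrow> l \<in> exc_set n"
proof -
  note D = Delta_large_l[OF assms(1)]
  note defs = approx_table_def lower_def upper_def pos_gap_def neg_gap_def
  have "\<not> Delta l n < 0" if "n \<in> {3, 6, 9, 12, 15, 18}"
    using that D(1)[of 3] D(1)[of 6] D(1)[of 9] D(1)[of 12] D(1)[of 15] D(1)[of 18] by (auto simp: defs)
  moreover have "Delta l n < 0" if "n \<in> {4, 7, 10, 13, 16, 19}"
    using that D(2)[of 4] D(2)[of 7] D(2)[of 10] D(2)[of 13] D(2)[of 16] D(2)[of 19] by (auto simp: defs)
  moreover have "\<not> Delta l n < 0" if "n \<in> {2, 5, 8, 11, 14, 17}"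
    using that D(3)[of 2] D(3)[of 5] D(3)[of 8] D(3)[of 11] D(3)[of 14] D(3)[of 17] by (auto simp: defs)
  moreover have "Delta l 20 < 0" using D(4)[of 20] by (simp add: defs)
  moreover have "n \<in> {3, 6, 9, 12, 15, 18} \<or> n \<in> {4, 7, 10, 13, 16, 19} \<or> n \<in> {2, 5, 8, 11, 14, 17} \<or> n = 20"
    using assms(2,3) by (simp only: insert_iff empty_iff) presburger
  ultimately show ?thesis using assms(1) by (auto simp: exc_set_def)
qed

text \<open>The case \<open>n = 1\<close> is outside the tables and is settled for all ranks at once
  from \<open>N l 2 = 2^l / 2\<close>.\<close>

lemma Delta_1: "Delta l 1 = 1 - 2 ^ l / 2"
proof -
  have "N l 1 = 1" using N_rec[of 1 l] subgroup_count_1[of l] by (simp add: N_0)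
  have "{1..2} = {1, 2::nat}" by auto
  then have "2 * N l 2 = of_nat (subgroup_count l 1) * N l 1 + of_nat (subgroup_count l 2) * N l 0"
    using N_rec[of 2 l] by simp
  then have "2 * N l 2 = 2 ^ l"
    unfolding subgroup_count_1 subgroup_count_2 N_0 \<open>N l 1 = 1\<close> by simp
  moreover have "Delta l 1 = N l 1 ^ 2 - N l 0 * N l 2"
    unfolding Delta_def one_add_one by simp
  ultimately show ?thesis unfolding N_0 \<open>N l 1 = 1\<close> by simp
qed

text \<open>A single permutation always commutes with itself, so the quotient is 1. In the
  recurrence this appears as all subgroup counts of rank 1 being 1. Hence
  \<open>Delta 1 n = 0\<close>, and rank 1 gives no exception.\<close>

lemma N_1: "N 1 n = 1"
proof (induction n rule: less_induct)
  case (less n)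
  show ?case
  proof (cases "n = 0")
    case False
    then have "of_nat n * N 1 n = (\<Sum>k=1..n. of_nat (subgroup_count 1 k) * N 1 (n - k))"
      by (intro N_rec) simp
    also have "\<dots> = (\<Sum>k=1..n. 1)"
    proof (rule sum.cong[OF refl])
      fix k assume k: "k \<in> {1..n}"
      then have "subgroup_count 1 k = 1" "N 1 (n - k) = 1"
        using subgroup_count_rank_1[of k] less[of "n - k"] by auto
      then show "of_nat (subgroup_count 1 k) * N 1 (n - k) = 1" by simp
    qed
    finally show ?thesis using False by simp
  qed (simp add: N_0)
qed

theorem theorem1p4:
  fixes n :: nat
  assumes "1 \<le> n" and "n \<le> 20"
  shows "{l::nat. 1 \<le> l \<and> Delta l n < 0} = exc_set n"
proof (rule set_eqI)
  fix l
  have exc: "2 \<le> l" if "l \<in> exc_set n"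
    using that by (auto simp: exc_set_def split: if_splits)
  have "1 \<le> l \<and> Delta l n < 0 \<longleftrightarrow> l \<in> exc_set n"
  proof (cases "2 \<le> l")
    case True
    show ?thesis
    proof (cases "n = 1")
      case n: True
      have "(2::rat) ^ 2 \<le> 2 ^ l" using True by (intro power_increasing) auto
      then show ?thesis using True unfolding n Delta_1 by (simp add: exc_set_def)
    next
      case False
      then have "2 \<le> n" using assms(1) by simp
      then show ?thesis
        using True Delta_small_l[of l n] Delta_large_l_exc_set[of l n] assms(2) by (cases "l < 80") auto
    qed
  next
    case False
    then have "\<not> (1 \<le> l \<and> Delta l n < 0)"
      using N_1 by (cases "l = 1") (auto simp: Delta_def)
    then show ?thesis using exc False by blast
  qed
  then show "l \<in> {l. 1 \<le> l \<and> Delta l n < 0} \<longleftrightarrow> l \<in> exc_set n" by simp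
qed

end
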